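(* For every $\lambda\in(0,+\infty)$, the Haagerup state $\varphi_\lambda$ on the full group $C^*$-algebra $C^*(\mathbb F_\infty)$ is weakly clustering with respect to the action of $\mathbb P_\infty$, and it is ergodic, i.e. an extreme point of the convex set of symmetric states on $C^*(\mathbb F_\infty)$.
   Context: $\mathbb F_\infty$ is the free group on generators $\{g_i\mid i\in\mathbb Z\}$. For a reduced word $w=g_{i_1}^{k_1}\cdots g_{i_n}^{k_n}$ (consecutive indices distinct, $k_j\in\mathbb Z\setminus\{0\}$) its length is $|w|=|k_1|+\cdots+|k_n|$, and the empty word has length $0$. $C^*(\mathbb F_\infty)$ is the full group $C^*$-algebra with canonical unitaries $\lambda_w$, $w\in\mathbb F_\infty$. The Haagerup state $\varphi_\lambda$ is the state determined by $\varphi_\lambda(\lambda_w)=e^{-\lambda|w|}$ (it is a known theorem of Haagerup that this defines a state). $\mathbb P_\infty$ is the group of permutations of $\mathbb Z$ moving only finitely many elements, acting on $C^*(\mathbb F_\infty)$ by automorphisms $\alpha_\sigma$ with $\alpha_\sigma(\lambda_{g_i})=\lambda_{g_{\sigma(i)}}$; for a finite $I\subset\mathbb Z$, $\mathbb P_I$ denotes the permutations moving only elements of $I$. A state is symmetric if it is invariant under all $\alpha_\sigma$. A symmetric state $\varphi$ is weakly clustering if for all $A,B\in C^*(\mathbb F_\infty)$, $\lim_{I\uparrow\mathbb Z}\frac1{|\mathbb P_I|}\sum_{\sigma\in\mathbb P_I}\varphi(\alpha_\sigma(A)B)=\varphi(A)\varphi(B)$, the limit being along finite subsets $I\subset\mathbb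 Z$ ordered by inclusion. *)

theory Defs
  imports "HOL-Analysis.Analysis" "HOL-Library.Poly_Mapping" "HOL-Combinatorics.Perm"
begin

section \<open>Free groups\<close>

text \<open>The list \<open>[(i\<^sub>1, k\<^sub>1), \<dots>, (i\<^sub>n, k\<^sub>n)]\<close> stands for the word
  \<open>g\<^bsub>i\<^sub>1\<^esub>\<^bsup>k\<^sub>1\<^esup> \<dots> g\<^bsub>i\<^sub>n\<^esub>\<^bsup>k\<^sub>n\<^esup>\<close>.\<close>

definition reduced :: "('i \<times> int) list \<Rightarrow> bool" where
  "reduced w \<longleftrightarrow> (\<forall>s\<in>set w. snd s \<noteq> 0) \<and> successively (\<lambda>s t. fst s \<noteq> fst t) w"

text \<open>\<open>push i k w\<close> is the reduced form of \<open>g\<^sub>i\<^sup>k w\<close>, for reduced \<open>w\<close>.\<close>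

fun push :: "'i \<Rightarrow> int \<Rightarrow> ('i \<times> int) list \<Rightarrow> ('i \<times> int) list" where
  "push i k [] = (if k = 0 then [] else [(i, k)])"
| "push i k ((j, l) # w) =
     (if k = 0 then (j, l) # w
      else if i = j then (if k + l = 0 then w else (i, k + l) # w)
      else (i, k) # (j, l) # w)"

definition word_mult :: "('i \<times> int) list \<Rightarrow> ('i \<times> int) list \<Rightarrow> ('i \<times> int) list" where
  "word_mult u v = foldr (\<lambda>(i, k). push i k) u v"

definition word_inv :: "('i \<times> int) list \<Rightarrow> ('i \<times> int) list" where
  "word_inv u = rev (map (\<lambda>(i, k). (i, - k)) u)"

lemma reduced_Nil [simp]: "reduced []"
  by (simp add: reduced_def)

lemma reduced_Cons:
  "reduced ((i, k) # w) \<longleftrightarrow> k \<noteq> 0 \<and> reduced w \<and> (w \<noteq> [] \<longrightarrow> fst (hd w) \<noteq> i)"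
  by (cases w) (auto simp: reduced_def)

lemma reduced_push: "reduced w \<Longrightarrow> reduced (push i k w)"
  by (induction i k w rule: push.induct) (auto simp: reduced_Cons)

lemma push_0 [simp]: "push i 0 w = w"
  by (cases w) auto

lemma push_push: "reduced w \<Longrightarrow> push i k (push i l w) = push i (k + l) w"
  by (cases w; cases "tl w") (auto simp: reduced_Cons add.assoc add_eq_0_iff)

lemma push_reduced: "reduced ((i, k) # w) \<Longrightarrow> push i k w = (i, k) # w"
  by (cases w) (auto simp: reduced_Cons)

lemma word_mult_Nil [simp]: "word_mult [] v = v"
  by (simp add: word_mult_def)

lemma word_mult_Cons [simp]: "word_mult ((i, k) # u) v = push i k (word_mult u v)"
  by (simp add: word_mult_def)

lemma word_mult_append: "word_mult (a @ b) v = word_mult a (word_mult b v)"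
  by (simp add: word_mult_def)

lemma reduced_word_mult: "reduced v \<Longrightarrow> reduced (word_mult u v)"
  by (induction u) (auto simp: reduced_push)

lemma word_mult_push:
  assumes "reduced v"
  shows "word_mult (push i k u) v = push i k (word_mult u v)"
proof (cases "(i, k, u)" rule: push.cases)
  case (2 i' k' j l w)
  then show ?thesis
    using push_push[OF reduced_word_mult[OF assms], of i k l w] by auto
qed auto

lemma word_mult_assoc:
  assumes "reduced v" "reduced w"
  shows "word_mult (word_mult u v) w = word_mult u (word_mult v w)"
  using assms by (induction u) (auto simp: word_mult_push)

lemma word_mult_Nil_right: "reduced u \<Longrightarrow> word_mult u [] = u"
  by (induction u) (auto simp: push_reduced, auto simp: reduced_Cons push_reduced)

lemma reduced_word_inv: "reduced u \<Longrightarrow> reduced (word_inv u)"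
  by (auto simp: reduced_def word_inv_def successively_rev successively_map
      case_prod_beta elim!: successively_mono)

lemma word_inv_mult: "word_mult (word_inv u) u = []" if "reduced u"
  using that
proof (induction u)
  case (Cons s u)
  obtain i k where s: "s = (i, k)"
    by force
  have "push i (- k) ((i, k) # u) = u"
    using Cons.prems by (simp add: s reduced_Cons)
  then show ?case
    using Cons by (simp add: s word_inv_def word_mult_append reduced_Cons)
qed (simp add: word_inv_def)

typedef 'i free_group = "{w :: ('i \<times> int) list. reduced w}"
  morphisms syllables Abs_free_group
  by (rule exI[of _ "[]"]) simp

setup_lifting type_definition_free_group

text \<open>The group operation is written additively, as everywhere in the class \<^class>\<open>group_add\<close>,
  which does not assume commutativity.\<close>

instantiation free_group :: (type) group_add
begin

lift_definition zero_free_group :: "'a free_group" is "[]"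
  by simp

lift_definition plus_free_group :: "'a free_group \<Rightarrow> 'a free_group \<Rightarrow> 'a free_group" is word_mult
  by (rule reduced_word_mult)

lift_definition uminus_free_group :: "'a free_group \<Rightarrow> 'a free_group" is word_inv
  by (rule reduced_word_inv)

definition minus_free_group :: "'a free_group \<Rightarrow> 'a free_group \<Rightarrow> 'a free_group" where
  "minus_free_group u v = u + - v"

instance
proof
  fix a b c :: "'a free_group"
  show "a + b + c = a + (b + c)"
    by transfer (rule word_mult_assoc)
  show "0 + a = a"
    by transfer simp
  show "a + 0 = a"
    by transfer (rule word_mult_Nil_right)
  show "- a + a = 0"
    by transfer (rule word_inv_mult)
  show "a + - b = a - b"
    by (simp add: minus_free_group_def)
qed

end

lift_definition generator :: "'i \<Rightarrow> 'i free_group" is "\<lambda>i. [(i, 1)]"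
  by (simp add: reduced_def)

lift_definition word_length :: "'i free_group \<Rightarrow> nat" is "\<lambda>w. \<Sum>(i, k)\<leftarrow>w. nat \<bar>k\<bar>" .

lift_definition permute_word :: "'i perm \<Rightarrow> 'i free_group \<Rightarrow> 'i free_group"
  is "\<lambda>\<sigma> w. map (\<lambda>(i, k). (Perm.apply \<sigma> i, k)) w"
  by (auto simp: reduced_def successively_map case_prod_beta apply_inj)

lemma push_map:
  "inj f \<Longrightarrow> push (f i) k (map (\<lambda>(i, k). (f i, k)) w) = map (\<lambda>(i, k). (f i, k)) (push i k w)"
  by (cases w) (auto simp: inj_eq)

lemma permute_word_add: "permute_word \<sigma> (u + v) = permute_word \<sigma> u + permute_word \<sigma> v"
proof transfer
  fix \<sigma> :: "'a perm" and u v :: "('a \<times> int) list"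
  have "inj (Perm.apply \<sigma>)"
    by (simp add: bij_is_inj)
  then show "map (\<lambda>(i, k). (Perm.apply \<sigma> i, k)) (word_mult u v) =
      word_mult (map (\<lambda>(i, k). (Perm.apply \<sigma> i, k)) u) (map (\<lambda>(i, k). (Perm.apply \<sigma> i, k)) v)"
    by (induction u) (auto simp flip: push_map)
qed

lemma permute_word_zero [simp]: "permute_word \<sigma> 0 = 0"
  by transfer simp

lemma permute_word_uminus: "permute_word \<sigma> (- u) = - permute_word \<sigma> u"
  by transfer (simp add: word_inv_def rev_map case_prod_beta comp_def)

lemma permute_word_generator: "permute_word \<sigma> (generator i) = generator (Perm.apply \<sigma> i)"
  by transfer simp


section \<open>C*-algebras\<close>

class cstar_algebra = real_normed_algebra_1 + complete_space +
  fixes scaleC :: "complex \<Rightarrow> 'a \<Rightarrow> 'a"  (infixr \<open>*\<^sub>C\<close> 75)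
    and adj :: "'a \<Rightarrow> 'a"
  assumes scaleC_add_right: "c *\<^sub>C (x + y) = c *\<^sub>C x + c *\<^sub>C y"
    and scaleC_add_left: "(c + d) *\<^sub>C x = c *\<^sub>C x + d *\<^sub>C x"
    and scaleC_scaleC: "c *\<^sub>C d *\<^sub>C x = (c * d) *\<^sub>C x"
    and scaleC_of_real: "complex_of_real r *\<^sub>C x = r *\<^sub>R x"
    and scaleC_mult_left: "(c *\<^sub>C x) * y = c *\<^sub>C (x * y)"
    and scaleC_mult_right: "x * (c *\<^sub>C y) = c *\<^sub>C (x * y)"
    and norm_scaleC: "norm (c *\<^sub>C x) = cmod c * norm x"
    and adj_adj: "adj (adj x) = x"
    and adj_add: "adj (x + y) = adj x + adj y"
    and adj_scaleC: "adj (c *\<^sub>C x) = cnj c *\<^sub>C adj x"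
    and adj_mult: "adj (x * y) = adj y * adj x"
    and cstar_identity: "norm (adj x * x) = (norm x)\<^sup>2"

text \<open>The type \<^typ>\<open>'a \<Rightarrow>\<^sub>L complex\<close> consists of the bounded real-linear maps; complex linearity is
  imposed separately.\<close>

definition states :: "('a::cstar_algebra \<Rightarrow>\<^sub>L complex) set" where
  "states = {\<phi> :: 'a \<Rightarrow>\<^sub>L complex. (\<forall>c a. \<phi> (c *\<^sub>C a) = c * \<phi> a) \<and> (\<forall>a. \<phi> (adj a * a) \<in> \<real>\<^sub>\<ge>\<^sub>0) \<and> \<phi> 1 = 1}"


section \<open>The complex group algebra and its largest C*-seminorm\<close>

type_synonym 'g group_algebra = "'g \<Rightarrow>\<^sub>0 complex"

definition ga_scale :: "complex \<Rightarrow> 'g::group_add group_algebra \<Rightarrow> 'g group_algebra" where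
  "ga_scale c x = Poly_Mapping.single 0 c * x"

definition ga_adj :: "'g::group_add group_algebra \<Rightarrow> 'g group_algebra" where
  "ga_adj x = (\<Sum>w\<in>Poly_Mapping.keys x. Poly_Mapping.single (- w) (cnj (Poly_Mapping.lookup x w)))"

definition ga_map :: "('g \<Rightarrow> 'h) \<Rightarrow> 'g group_algebra \<Rightarrow> 'h group_algebra" where
  "ga_map h x = (\<Sum>w\<in>Poly_Mapping.keys x. Poly_Mapping.single (h w) (Poly_Mapping.lookup x w))"

definition cstar_seminorm :: "('g::group_add group_algebra \<Rightarrow> real) \<Rightarrow> bool" where
  "cstar_seminorm p \<longleftrightarrow>
     (\<forall>x y. p (x + y) \<le> p x + p y) \<and> (\<forall>c x. p (ga_scale c x) = cmod c * p x) \<and>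
     (\<forall>x y. p (x * y) \<le> p x * p y) \<and> (\<forall>x. p (ga_adj x * x) = (p x)\<^sup>2)"

text \<open>Every *-representation \<open>\<pi>\<close> of the group algebra by bounded operators on a Hilbert space yields a
  C*-seminorm \<open>\<lambda>x. \<parallel>\<pi> x\<parallel>\<close>, and every C*-seminorm is of this form, so this is the usual
  norm of the full group C*-algebra. Speaking of seminorms avoids a quantification over the
  types that carry the representation spaces.\<close>

definition max_norm :: "'g::group_add group_algebra \<Rightarrow> real" where
  "max_norm x = (SUP p\<in>{p. cstar_seminorm p}. p x)"

lemma ga_extend_add:
  fixes f :: "'g \<Rightarrow> complex \<Rightarrow> 'b::comm_monoid_add"
  assumes 0: "\<And>w. f w 0 = 0" and add: "\<And>w a b. f w (a + b) = f w a + f w b"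
  shows "(\<Sum>w\<in>Poly_Mapping.keys (x + y). f w (Poly_Mapping.lookup (x + y) w)) =
    (\<Sum>w\<in>Poly_Mapping.keys x. f w (Poly_Mapping.lookup x w)) +
    (\<Sum>w\<in>Poly_Mapping.keys y. f w (Poly_Mapping.lookup y w))"
proof -
  let ?K = "Poly_Mapping.keys x \<union> Poly_Mapping.keys y"
  have *: "(\<Sum>w\<in>Poly_Mapping.keys z. f w (Poly_Mapping.lookup z w)) =
      (\<Sum>w\<in>?K. f w (Poly_Mapping.lookup z w))" if "Poly_Mapping.keys z \<subseteq> ?K" for z
    by (rule sum.mono_neutral_left) (use that 0 in \<open>auto simp: in_keys_iff\<close>)
  show ?thesis
    unfolding *[OF keys_add] *[OF Un_upper1] *[OF Un_upper2]
    by (simp add: lookup_add add sum.distrib)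
qed

lemma ga_induct [case_names zero single add]:
  fixes x :: "'g group_algebra"
  assumes "P 0" "\<And>w c. P (Poly_Mapping.single w c)" "\<And>x y. P x \<Longrightarrow> P y \<Longrightarrow> P (x + y)"
  shows "P x"
proof -
  have "P (\<Sum>w\<in>A. Poly_Mapping.single w (Poly_Mapping.lookup x w))" if "finite A" for A
    using that by induction (auto intro: assms)
  moreover have "(\<Sum>w\<in>Poly_Mapping.keys x. Poly_Mapping.single w (Poly_Mapping.lookup x w)) = x"
    by (rule poly_mapping_eqI)
       (auto simp: lookup_sum lookup_single when_def in_keys_iff sum.delta)
  ultimately show ?thesis
    by (metis finite_keys)
qed

lemma ga_adj_add: "ga_adj (x + y) = ga_adj x + ga_adj y"
  unfolding ga_adj_def by (rule ga_extend_add) (auto simp: single_add)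

lemma ga_adj_single [simp]: "ga_adj (Poly_Mapping.single w c) = Poly_Mapping.single (- w) (cnj c)"
  by (simp add: ga_adj_def)

lemma ga_adj_0 [simp]: "ga_adj 0 = 0"
  by (simp add: ga_adj_def)

lemma ga_adj_uminus: "ga_adj (- x) = - ga_adj x"
  by (metis add_eq_0_iff ga_adj_0 ga_adj_add)

lemma ga_adj_diff: "ga_adj (x - y) = ga_adj x - ga_adj y"
  by (metis ga_adj_add ga_adj_uminus diff_conv_add_uminus)

lemma ga_adj_adj: "ga_adj (ga_adj x) = x"
  by (induction x rule: ga_induct) (auto simp: ga_adj_add)

lemma ga_adj_mult: "ga_adj (x * y) = ga_adj y * ga_adj x"
proof (induction x rule: ga_induct)
  case (single w c)
  show ?case
    by (induction y rule: ga_induct)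
       (auto simp: ga_adj_add mult_single minus_add distrib_left distrib_right mult.commute)
qed (auto simp: ga_adj_add distrib_left distrib_right)

lemma ga_map_add: "ga_map h (x + y) = ga_map h x + ga_map h y"
  unfolding ga_map_def by (rule ga_extend_add) (auto simp: single_add)

lemma ga_map_single [simp]: "ga_map h (Poly_Mapping.single w c) = Poly_Mapping.single (h w) c"
  by (simp add: ga_map_def)

lemma ga_map_0 [simp]: "ga_map h 0 = 0"
  by (simp add: ga_map_def)

lemma ga_map_uminus: "ga_map h (- x) = - ga_map h x"
  by (metis add_eq_0_iff ga_map_0 ga_map_add)

lemma ga_map_diff: "ga_map h (x - y) = ga_map h x - ga_map h y"
  by (metis ga_map_add ga_map_uminus diff_conv_add_uminus)

lemma ga_map_mult:
  assumes "\<And>u v. h (u + v) = h u + h v"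
  shows "ga_map h (x * y) = ga_map h x * ga_map h y"
proof (induction x rule: ga_induct)
  case (single w c)
  show ?case
    by (induction y rule: ga_induct)
       (auto simp: ga_map_add mult_single assms distrib_left distrib_right)
qed (auto simp: ga_map_add distrib_left distrib_right)

lemma ga_map_adj:
  assumes "\<And>u. h (- u) = - h u"
  shows "ga_map h (ga_adj x) = ga_adj (ga_map h x)"
  by (induction x rule: ga_induct) (auto simp: ga_map_add ga_adj_add assms)

lemma ga_scale_single [simp]:
  "ga_scale c (Poly_Mapping.single w d) = Poly_Mapping.single w (c * d)"
  by (simp add: ga_scale_def mult_single)

lemma ga_scale_add: "ga_scale c (x + y) = ga_scale c x + ga_scale c y"
  by (simp add: ga_scale_def distrib_left)

lemma ga_scale_add_left: "ga_scale (c + d) x = ga_scale c x + ga_scale d x"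
  by (simp add: ga_scale_def single_add distrib_right)

lemma ga_scale_diff: "ga_scale c (x - y) = ga_scale c x - ga_scale c y"
  by (simp add: ga_scale_def right_diff_distrib)

lemma ga_scale_0 [simp]: "ga_scale c 0 = 0" "ga_scale 0 x = 0"
  by (simp_all add: ga_scale_def)

lemma ga_scale_1 [simp]: "ga_scale 1 x = x"
  by (simp add: ga_scale_def)

lemma ga_scale_minus1 [simp]: "ga_scale (- 1) x = - x"
  by (simp add: ga_scale_def single_uminus)

lemma ga_scale_scale: "ga_scale c (ga_scale d x) = ga_scale (c * d) x"
  by (simp add: ga_scale_def mult_single flip: mult.assoc)

lemma ga_scale_mult_left: "ga_scale c x * y = ga_scale c (x * y)"
  by (simp add: ga_scale_def mult.assoc)

lemma ga_scale_mult_right: "x * ga_scale c y = ga_scale c (x * y)"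
proof (induction x rule: ga_induct)
  case (single w d)
  show ?case
    by (induction y rule: ga_induct)
       (auto simp: ga_scale_add mult_single distrib_left mult.left_commute)
qed (auto simp: ga_scale_add distrib_right)

lemma ga_adj_scale: "ga_adj (ga_scale c x) = ga_scale (cnj c) (ga_adj x)"
  by (induction x rule: ga_induct) (auto simp: ga_adj_add ga_scale_add)

lemma ga_map_scale: "ga_map h (ga_scale c x) = ga_scale c (ga_map h x)"
  by (induction x rule: ga_induct) (auto simp: ga_map_add ga_scale_add)

context
  fixes p :: "'g::group_add group_algebra \<Rightarrow> real"
  assumes p: "cstar_seminorm p"
begin

lemma cstar_seminorm_add: "p (x + y) \<le> p x + p y"
  and cstar_seminorm_scale: "p (ga_scale c x) = cmod c * p x"
  and cstar_seminorm_mult: "p (x * y) \<le> p x * p y"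
  and cstar_seminorm_cstar: "p (ga_adj x * x) = (p x)\<^sup>2"
  using p by (auto simp: cstar_seminorm_def)

lemma cstar_seminorm_0: "p 0 = 0"
  using cstar_seminorm_scale[of 0 0] by simp

lemma cstar_seminorm_uminus: "p (- x) = p x"
  using cstar_seminorm_scale[of "-1" x] by simp

lemma cstar_seminorm_nonneg: "0 \<le> p x"
  using cstar_seminorm_add[of x "- x"] by (simp add: cstar_seminorm_0 cstar_seminorm_uminus)

lemma cstar_seminorm_single: "p (Poly_Mapping.single w c) \<le> cmod c"
proof -
  have one: "p 1 = (p 1)\<^sup>2"
    using cstar_seminorm_cstar[of "Poly_Mapping.single 0 1"] unfolding ga_adj_single
    by (simp add: mult_single)
  then have "p 1 \<le> 1"
    by (auto simp: power2_eq_square)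
  moreover have "p 1 = (p (Poly_Mapping.single w 1))\<^sup>2"
    using cstar_seminorm_cstar[of "Poly_Mapping.single w 1"] by (simp add: mult_single)
  ultimately have "p (Poly_Mapping.single w 1) \<le> 1"
    using power2_le_imp_le[of _ "1 :: real"] by simp
  then have "cmod c * p (Poly_Mapping.single w 1) \<le> cmod c"
    by (simp add: mult_left_le)
  then show ?thesis
    using cstar_seminorm_scale[of c "Poly_Mapping.single w 1"] by simp
qed

end

lemma cstar_seminorm_bounded:
  fixes x :: "'g::group_add group_algebra"
  shows "\<exists>b. \<forall>p. cstar_seminorm p \<longrightarrow> p x \<le> b"
proof (induction x rule: ga_induct)
  case zero
  show ?case
    using cstar_seminorm_0 by (metis order.refl)
next
  case (single w c)
  show ?case
    using cstar_seminorm_single by blast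
next
  case (add x y)
  then obtain a b where "\<forall>p. cstar_seminorm p \<longrightarrow> p x \<le> a" "\<forall>p. cstar_seminorm p \<longrightarrow> p y \<le> b"
    by blast
  then show ?case
    by (intro exI[of _ "a + b"]) (meson add_mono cstar_seminorm_add order_trans)
qed

lemma bdd_above_seminorms: "bdd_above ((\<lambda>p. p x) ` {p. cstar_seminorm p})"
  using cstar_seminorm_bounded[of x] by (auto simp: bdd_above_def)

lemma cstar_seminorm_zero: "cstar_seminorm (\<lambda>x. 0)"
  by (simp add: cstar_seminorm_def)

lemma cstar_seminorm_le_max_norm: "cstar_seminorm p \<Longrightarrow> p x \<le> max_norm x"
  unfolding max_norm_def by (rule cSUP_upper) (auto intro: bdd_above_seminorms)

lemma max_norm_le: "(\<And>p. cstar_seminorm p \<Longrightarrow> p x \<le> b) \<Longrightarrow> max_norm x \<le> b"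
  unfolding max_norm_def by (rule cSUP_least) (use cstar_seminorm_zero in auto)

lemma max_norm_nonneg: "0 \<le> max_norm x"
  using cstar_seminorm_le_max_norm[OF cstar_seminorm_zero] .

lemma max_norm_scale_le: "max_norm (ga_scale c x) \<le> cmod c * max_norm x"
  by (rule max_norm_le) (simp add: cstar_seminorm_scale mult_left_mono cstar_seminorm_le_max_norm)

lemma cstar_seminorm_max_norm:
  "cstar_seminorm (max_norm :: 'g::group_add group_algebra \<Rightarrow> real)"
  unfolding cstar_seminorm_def
proof (intro conjI allI)
  fix x y :: "'g group_algebra" and c
  show "max_norm (x + y) \<le> max_norm x + max_norm y"
    by (rule max_norm_le) (meson add_mono cstar_seminorm_add cstar_seminorm_le_max_norm order_trans)
  show mult: "max_norm (x * y) \<le> max_norm x * max_norm y" for x y :: "'g group_algebra"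
    by (rule max_norm_le)
       (meson cstar_seminorm_le_max_norm cstar_seminorm_mult cstar_seminorm_nonneg max_norm_nonneg
          mult_mono order_trans)
  show "max_norm (ga_scale c x) = cmod c * max_norm x"
  proof (cases "c = 0")
    case True
    then show ?thesis
      using max_norm_scale_le[of 0 x] max_norm_nonneg[of "0 :: 'g group_algebra"] by auto
  next
    case False
    have "max_norm x = max_norm (ga_scale (inverse c) (ga_scale c x))"
      using False by (simp add: ga_scale_scale)
    also have "\<dots> \<le> cmod (inverse c) * max_norm (ga_scale c x)"
      by (rule max_norm_scale_le)
    finally have "cmod c * max_norm x \<le> max_norm (ga_scale c x)"
      using False by (simp add: norm_inverse norm_divide field_simps)
    then show ?thesis
      using max_norm_scale_le[of c x] by linarith
  qed
  show "max_norm (ga_adj x * x) = (max_norm x)\<^sup>2"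
  proof (rule antisym)
    show "max_norm (ga_adj x * x) \<le> (max_norm x)\<^sup>2"
      by (rule max_norm_le)
         (simp add: cstar_seminorm_cstar power_mono cstar_seminorm_nonneg cstar_seminorm_le_max_norm)
    have "max_norm x \<le> sqrt (max_norm (ga_adj x * x))"
      by (rule max_norm_le)
         (metis cstar_seminorm_cstar cstar_seminorm_le_max_norm cstar_seminorm_nonneg
            real_le_rsqrt)
    then show "(max_norm x)\<^sup>2 \<le> max_norm (ga_adj x * x)"
      by (metis max_norm_nonneg real_sqrt_le_mono real_sqrt_unique power_mono real_sqrt_pow2)
  qed
qed

lemmas max_norm_add = cstar_seminorm_add[OF cstar_seminorm_max_norm]
  and max_norm_scale = cstar_seminorm_scale[OF cstar_seminorm_max_norm]
  and max_norm_mult = cstar_seminorm_mult[OF cstar_seminorm_max_norm]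
  and max_norm_cstar = cstar_seminorm_cstar[OF cstar_seminorm_max_norm]
  and max_norm_0 [simp] = cstar_seminorm_0[OF cstar_seminorm_max_norm]
  and max_norm_uminus [simp] = cstar_seminorm_uminus[OF cstar_seminorm_max_norm]
  and max_norm_single = cstar_seminorm_single[OF cstar_seminorm_max_norm]

lemma max_norm_diff_commute: "max_norm (x - y) = max_norm (y - x)"
  by (metis max_norm_uminus minus_diff_eq)

lemma max_norm_triangle: "max_norm (x - z) \<le> max_norm (x - y) + max_norm (y - z)"
  using max_norm_add[of "x - y" "y - z"] by simp

lemma max_norm_diff_abs: "\<bar>max_norm x - max_norm y\<bar> \<le> max_norm (x - y)"
  using max_norm_add[of "x - y" y] max_norm_add[of "y - x" x] max_norm_diff_commute[of x y] by simp

lemma max_norm_adj [simp]: "max_norm (ga_adj x) = max_norm x"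
proof -
  have "max_norm x \<le> max_norm (ga_adj x)" for x :: "'a group_algebra"
  proof (cases "max_norm x = 0")
    case False
    have "max_norm x * max_norm x \<le> max_norm (ga_adj x) * max_norm x"
      using max_norm_mult[of "ga_adj x" x] by (simp add: max_norm_cstar power2_eq_square)
    then show ?thesis
      using False max_norm_nonneg[of x] by simp
  qed (simp add: max_norm_nonneg)
  from this[of x] this[of "ga_adj x"] show ?thesis
    by (simp add: ga_adj_adj)
qed

lemma max_norm_ga_map_le:
  fixes h :: "'g::group_add \<Rightarrow> 'h::group_add"
  assumes add: "\<And>u v. h (u + v) = h u + h v"
  shows "max_norm (ga_map h x) \<le> max_norm x"
proof -
  have "h 0 = 0"
    using add[of 0 0] by (metis add.right_neutral add_left_cancel)
  then have "h (- u) = - h u" for u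
    using add[of u "- u"] by (simp add: minus_unique)
  then have "cstar_seminorm (\<lambda>x. p (ga_map h x))" if "cstar_seminorm p" for p
    using that unfolding cstar_seminorm_def
    by (simp add: ga_map_add ga_map_scale ga_map_mult[of h, OF add] ga_map_adj)
  then show ?thesis
    by (intro max_norm_le) (rule cstar_seminorm_le_max_norm)
qed

text \<open>The trivial representation shows that the norm does not vanish.\<close>

lemma max_norm_1 [simp]: "max_norm (1 :: 'g::group_add group_algebra) = 1"
proof -
  define e :: "'g group_algebra \<Rightarrow> complex"
    where "e x = (\<Sum>w\<in>Poly_Mapping.keys x. Poly_Mapping.lookup x w)" for x
  have add: "e (x + y) = e x + e y" for x y
    unfolding e_def by (rule ga_extend_add) auto
  have single [simp]: "e (Poly_Mapping.single w c) = c" for w c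
    by (simp add: e_def)
  have [simp]: "e 0 = 0"
    by (simp add: e_def)
  have mult: "e (x * y) = e x * e y" for x y
  proof (induction x rule: ga_induct)
    case (single w c)
    show ?case
      by (induction y rule: ga_induct) (auto simp: add mult_single distrib_left)
  qed (auto simp: add distrib_right)
  have adj: "e (ga_adj x) = cnj (e x)" for x
    by (induction x rule: ga_induct) (auto simp: add ga_adj_add)
  have "cstar_seminorm (\<lambda>x. cmod (e x))"
    by (auto simp: cstar_seminorm_def add mult adj norm_mult norm_triangle_ineq power2_eq_square
        ga_scale_def)
  then have "1 \<le> max_norm (1 :: 'g group_algebra)"
    using cstar_seminorm_le_max_norm[of "\<lambda>x. cmod (e x)" 1] single[of 0 1] by simp
  moreover have "max_norm (1 :: 'g group_algebra) \<le> 1"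
    using max_norm_single[of 0 1] by simp
  ultimately show ?thesis
    by simp
qed


section \<open>The full group C*-algebra\<close>

text \<open>This is the completion of the group algebra with respect to \<^const>\<open>max_norm\<close>, by Cauchy
  sequences. (Identifying sequences whose difference tends to zero in particular divides out
  elements of norm zero, if there are any.)\<close>

definition ga_cauchy :: "(nat \<Rightarrow> 'g::group_add group_algebra) \<Rightarrow> bool" where
  "ga_cauchy X \<longleftrightarrow> (\<forall>e>0. \<exists>N. \<forall>m\<ge>N. \<forall>n\<ge>N. max_norm (X m - X n) < e)"

definition cauchy_rel ::
  "(nat \<Rightarrow> 'g::group_add group_algebra) \<Rightarrow> (nat \<Rightarrow> 'g group_algebra) \<Rightarrow> bool" where
  "cauchy_rel X Y \<longleftrightarrow> ga_cauchy X \<and> ga_cauchy Y \<and> (\<lambda>n. max_norm (X n - Y n)) \<longlonglongrightarrow> 0"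

lemma vanishing_le:
  assumes "Y \<longlonglongrightarrow> 0" "\<And>n. max_norm (X n) \<le> Y n"
  shows "(\<lambda>n. max_norm (X n)) \<longlonglongrightarrow> 0"
  by (rule tendsto_sandwich[OF _ _ tendsto_const assms(1)]) (simp_all add: assms(2) max_norm_nonneg)

lemma ga_cauchy_const [simp]: "ga_cauchy (\<lambda>n. x)"
  by (simp add: ga_cauchy_def)

lemma ga_cauchy_lipschitz:
  assumes "ga_cauchy X" and F: "\<And>x y. max_norm (F x - F y) \<le> L * max_norm (x - y)"
  shows "ga_cauchy (\<lambda>n. F (X n))"
  unfolding ga_cauchy_def
proof (intro allI impI)
  fix e :: real
  assume "e > 0"
  then have "e / (\<bar>L\<bar> + 1) > 0"
    by simp
  then obtain N where N: "\<forall>m\<ge>N. \<forall>n\<ge>N. max_norm (X m - X n) < e / (\<bar>L\<bar> + 1)"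
    using assms(1) unfolding ga_cauchy_def by blast
  have "max_norm (F (X m) - F (X n)) < e" if "m \<ge> N" "n \<ge> N" for m n
  proof -
    have "max_norm (F (X m) - F (X n)) \<le> (\<bar>L\<bar> + 1) * max_norm (X m - X n)"
      by (rule order_trans[OF F mult_right_mono]) (auto simp: max_norm_nonneg)
    also have "\<dots> < e"
      using N that by (simp add: field_simps)
    finally show ?thesis .
  qed
  then show "\<exists>N. \<forall>m\<ge>N. \<forall>n\<ge>N. max_norm (F (X m) - F (X n)) < e"
    by blast
qed

lemma vanishing_lipschitz:
  assumes "(\<lambda>n. max_norm (X n - Y n)) \<longlonglongrightarrow> 0"
    and F: "\<And>x y. max_norm (F x - F y) \<le> L * max_norm (x - y)"
  shows "(\<lambda>n. max_norm (F (X n) - F (Y n))) \<longlonglongrightarrow> 0"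
  by (rule vanishing_le[OF tendsto_mult_right_zero[OF assms(1), of L] F])

lemma cauchy_rel_lipschitz:
  assumes "cauchy_rel X Y" "\<And>x y. max_norm (F x - F y) \<le> L * max_norm (x - y)"
  shows "cauchy_rel (\<lambda>n. F (X n)) (\<lambda>n. F (Y n))"
  using assms(1) ga_cauchy_lipschitz[of _ F L, OF _ assms(2)]
    vanishing_lipschitz[of X Y F L, OF _ assms(2)] unfolding cauchy_rel_def by blast

lemma ga_cauchy_add [simp]:
  assumes "ga_cauchy X" "ga_cauchy Y"
  shows "ga_cauchy (\<lambda>n. X n + Y n)"
  unfolding ga_cauchy_def
proof (intro allI impI)
  fix e :: real
  assume "e > 0"
  then have e: "e / 2 > 0"
    by simp
  obtain M where M: "\<forall>m\<ge>M. \<forall>n\<ge>M. max_norm (X m - X n) < e / 2"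
    using assms(1) e unfolding ga_cauchy_def by blast
  obtain N where N: "\<forall>m\<ge>N. \<forall>n\<ge>N. max_norm (Y m - Y n) < e / 2"
    using assms(2) e unfolding ga_cauchy_def by blast
  have "max_norm ((X m + Y m) - (X n + Y n)) < e" if "m \<ge> max M N" "n \<ge> max M N" for m n
  proof -
    have "max_norm ((X m + Y m) - (X n + Y n)) \<le> max_norm (X m - X n) + max_norm (Y m - Y n)"
      using max_norm_add[of "X m - X n" "Y m - Y n"] by (simp add: add_diff_add)
    also have "\<dots> < e / 2 + e / 2"
      using M N that by (intro add_strict_mono) auto
    finally show ?thesis
      by simp
  qed
  then show "\<exists>N. \<forall>m\<ge>N. \<forall>n\<ge>N. max_norm ((X m + Y m) - (X n + Y n)) < e"
    by blast
qed

lemma ga_cauchy_uminus [simp]: "ga_cauchy X \<Longrightarrow> ga_cauchy (\<lambda>n. - X n)"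
  by (rule ga_cauchy_lipschitz[where L = 1])
     (auto simp: max_norm_diff_commute minus_diff_minus simp del: minus_diff_eq)

lemma ga_cauchy_diff [simp]: "ga_cauchy X \<Longrightarrow> ga_cauchy Y \<Longrightarrow> ga_cauchy (\<lambda>n. X n - Y n)"
  using ga_cauchy_add[of X "\<lambda>n. - Y n"] by simp

lemma ga_cauchy_scale [simp]: "ga_cauchy X \<Longrightarrow> ga_cauchy (\<lambda>n. ga_scale c (X n))"
  by (rule ga_cauchy_lipschitz[where L = "cmod c"])
     (auto simp: max_norm_scale simp flip: ga_scale_diff)

lemma ga_cauchy_adj [simp]: "ga_cauchy X \<Longrightarrow> ga_cauchy (\<lambda>n. ga_adj (X n))"
  by (rule ga_cauchy_lipschitz[where L = 1]) (auto simp flip: ga_adj_diff)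

lemma ga_cauchy_norm_convergent:
  assumes "ga_cauchy X"
  shows "convergent (\<lambda>n. max_norm (X n))"
proof -
  have "Cauchy (\<lambda>n. max_norm (X n))"
    using assms unfolding Cauchy_def ga_cauchy_def dist_real_def
    by (meson max_norm_diff_abs le_less_trans)
  then show ?thesis
    by (rule Cauchy_convergent)
qed

lemma ga_cauchy_norm_LIMSEQ:
  "ga_cauchy X \<Longrightarrow> (\<lambda>n. max_norm (X n)) \<longlonglongrightarrow> lim (\<lambda>n. max_norm (X n))"
  using ga_cauchy_norm_convergent convergent_LIMSEQ_iff by blast

lemma ga_cauchy_bounded:
  assumes "ga_cauchy X"
  obtains b where "b > 0" "\<And>n. max_norm (X n) \<le> b"
proof -
  have "Bseq (\<lambda>n. max_norm (X n))"
    using ga_cauchy_norm_convergent[OF assms] by (rule convergent_imp_Bseq)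
  then show ?thesis
    using that by (auto elim!: BseqE simp: max_norm_nonneg)
qed

lemma max_norm_mult_diff:
  assumes "max_norm x \<le> a" "max_norm y' \<le> b"
  shows "max_norm (x * y - x' * y') \<le> a * max_norm (y - y') + b * max_norm (x - x')"
proof -
  have "max_norm (x * y - x' * y') = max_norm (x * (y - y') + (x - x') * y')"
    by (simp add: algebra_simps)
  also have "\<dots> \<le> max_norm x * max_norm (y - y') + max_norm (x - x') * max_norm y'"
    by (meson add_mono max_norm_add max_norm_mult order_trans)
  also have "\<dots> \<le> a * max_norm (y - y') + max_norm (x - x') * b"
    by (intro add_mono mult_right_mono mult_left_mono assms max_norm_nonneg)
  finally show ?thesis
    by (simp add: mult.commute)
qed

lemma ga_cauchy_mult [simp]:
  assumes "ga_cauchy X" "ga_cauchy Y"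
  shows "ga_cauchy (\<lambda>n. X n * Y n)"
  unfolding ga_cauchy_def
proof (intro allI impI)
  fix e :: real
  assume "e > 0"
  obtain a where a: "a > 0" "\<And>n. max_norm (X n) \<le> a"
    using ga_cauchy_bounded[OF assms(1)] by blast
  obtain b where b: "b > 0" "\<And>n. max_norm (Y n) \<le> b"
    using ga_cauchy_bounded[OF assms(2)] by blast
  have ea: "e / (2 * b) > 0" and eb: "e / (2 * a) > 0"
    using \<open>e > 0\<close> a b by simp_all
  obtain M where M: "\<forall>m\<ge>M. \<forall>n\<ge>M. max_norm (X m - X n) < e / (2 * b)"
    using assms(1) ea unfolding ga_cauchy_def by blast
  obtain N where N: "\<forall>m\<ge>N. \<forall>n\<ge>N. max_norm (Y m - Y n) < e / (2 * a)"
    using assms(2) eb unfolding ga_cauchy_def by blast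
  have "max_norm (X m * Y m - X n * Y n) < e" if "m \<ge> max M N" "n \<ge> max M N" for m n
  proof -
    have "max_norm (X m * Y m - X n * Y n) \<le> a * max_norm (Y m - Y n) + b * max_norm (X m - X n)"
      by (intro max_norm_mult_diff a b)
    also have "\<dots> < a * (e / (2 * a)) + b * (e / (2 * b))"
      using M N that a b by (intro add_strict_mono mult_strict_left_mono) auto
    finally show ?thesis
      using a b by simp
  qed
  then show "\<exists>N. \<forall>m\<ge>N. \<forall>n\<ge>N. max_norm (X m * Y m - X n * Y n) < e"
    by blast
qed

lemma cauchy_rel_add:
  assumes "cauchy_rel X X'" "cauchy_rel Y Y'"
  shows "cauchy_rel (\<lambda>n. X n + Y n) (\<lambda>n. X' n + Y' n)"
proof -
  have "(\<lambda>n. max_norm (X n - X' n) + max_norm (Y n - Y' n)) \<longlonglongrightarrow> 0"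
    using assms unfolding cauchy_rel_def by (intro tendsto_add_zero) auto
  then have "(\<lambda>n. max_norm ((X n - X' n) + (Y n - Y' n))) \<longlonglongrightarrow> 0"
    by (rule vanishing_le[OF _ max_norm_add])
  then show ?thesis
    using assms by (simp add: cauchy_rel_def add_diff_add)
qed

lemma cauchy_rel_mult:
  assumes "cauchy_rel X X'" "cauchy_rel Y Y'"
  shows "cauchy_rel (\<lambda>n. X n * Y n) (\<lambda>n. X' n * Y' n)"
proof -
  obtain a where a: "a > 0" "\<And>n. max_norm (X n) \<le> a"
    using ga_cauchy_bounded assms(1) unfolding cauchy_rel_def by blast
  obtain b where b: "b > 0" "\<And>n. max_norm (Y' n) \<le> b"
    using ga_cauchy_bounded assms(2) unfolding cauchy_rel_def by blast
  have "(\<lambda>n. a * max_norm (Y n - Y' n) + b * max_norm (X n - X' n)) \<longlonglongrightarrow> 0"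
    using assms unfolding cauchy_rel_def
    by (intro tendsto_add_zero tendsto_mult_right_zero) auto
  then have "(\<lambda>n. max_norm (X n * Y n - X' n * Y' n)) \<longlonglongrightarrow> 0"
    by (rule vanishing_le) (intro max_norm_mult_diff a b)
  then show ?thesis
    using assms by (simp add: cauchy_rel_def)
qed

lemma cauchy_rel_refl: "ga_cauchy X \<Longrightarrow> cauchy_rel X X"
  by (simp add: cauchy_rel_def)

lemma cauchy_rel_uminus: "cauchy_rel X Y \<Longrightarrow> cauchy_rel (\<lambda>n. - X n) (\<lambda>n. - Y n)"
  by (rule cauchy_rel_lipschitz[where L = 1])
     (auto simp: max_norm_diff_commute minus_diff_minus simp del: minus_diff_eq)

lemma cauchy_rel_scale: "cauchy_rel X Y \<Longrightarrow> cauchy_rel (\<lambda>n. ga_scale c (X n)) (\<lambda>n. ga_scale c (Y n))"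
  by (rule cauchy_rel_lipschitz[where L = "cmod c"])
     (auto simp: max_norm_scale simp flip: ga_scale_diff)

lemma cauchy_rel_adj: "cauchy_rel X Y \<Longrightarrow> cauchy_rel (\<lambda>n. ga_adj (X n)) (\<lambda>n. ga_adj (Y n))"
  by (rule cauchy_rel_lipschitz[where L = 1]) (auto simp flip: ga_adj_diff)

lemma part_equivp_cauchy_rel: "part_equivp cauchy_rel"
proof (rule part_equivpI)
  show "\<exists>X. cauchy_rel X X"
    using cauchy_rel_refl ga_cauchy_const by blast
  show "symp cauchy_rel"
    by (auto simp: symp_def cauchy_rel_def max_norm_diff_commute)
  show "transp cauchy_rel"
  proof (rule transpI)
    fix X Y Z
    assume XY: "cauchy_rel X Y" and YZ: "cauchy_rel Y Z"
    have "(\<lambda>n. max_norm (X n - Y n) + max_norm (Y n - Z n)) \<longlonglongrightarrow> 0"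
      using XY YZ unfolding cauchy_rel_def by (intro tendsto_add_zero) auto
    then have "(\<lambda>n. max_norm (X n - Z n)) \<longlonglongrightarrow> 0"
      by (rule vanishing_le[OF _ max_norm_triangle])
    then show "cauchy_rel X Z"
      using XY YZ by (simp add: cauchy_rel_def)
  qed
qed

quotient_type (overloaded) 'g group_cstar =
  "nat \<Rightarrow> 'g::group_add group_algebra" / partial: cauchy_rel
  by (rule part_equivp_cauchy_rel)

instantiation group_cstar :: (group_add) ring_1
begin

lift_definition zero_group_cstar :: "'a group_cstar" is "\<lambda>n. 0"
  by (simp add: cauchy_rel_refl)

lift_definition one_group_cstar :: "'a group_cstar" is "\<lambda>n. 1"
  by (simp add: cauchy_rel_refl)

lift_definition plus_group_cstar :: "'a group_cstar \<Rightarrow> 'a group_cstar \<Rightarrow> 'a group_cstar"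
  is "\<lambda>X Y n. X n + Y n"
  by (rule cauchy_rel_add)

lift_definition times_group_cstar :: "'a group_cstar \<Rightarrow> 'a group_cstar \<Rightarrow> 'a group_cstar"
  is "\<lambda>X Y n. X n * Y n"
  by (rule cauchy_rel_mult)

lift_definition uminus_group_cstar :: "'a group_cstar \<Rightarrow> 'a group_cstar" is "\<lambda>X n. - X n"
  by (rule cauchy_rel_uminus)

lift_definition minus_group_cstar :: "'a group_cstar \<Rightarrow> 'a group_cstar \<Rightarrow> 'a group_cstar"
  is "\<lambda>X Y n. X n - Y n"
  using cauchy_rel_add[OF _ cauchy_rel_uminus] by fastforce

instance
proof
  fix a b c :: "'a group_cstar"
  show "a + b + c = a + (b + c)" "a + b = b + a" "0 + a = a" "- a + a = 0" "a - b = a + - b"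
    "a * b * c = a * (b * c)" "1 * a = a" "a * 1 = a"
    "(a + b) * c = a * c + b * c" "a * (b + c) = a * b + a * c"
    by (transfer; simp add: cauchy_rel_def algebra_simps)+
  show "(0 :: 'a group_cstar) \<noteq> 1"
    by transfer (simp add: cauchy_rel_def LIMSEQ_const_iff)
qed

end

instantiation group_cstar :: (group_add) real_normed_algebra_1
begin

lift_definition norm_group_cstar :: "'a group_cstar \<Rightarrow> real" is "\<lambda>X. lim (\<lambda>n. max_norm (X n))"
proof -
  fix X Y :: "nat \<Rightarrow> 'a group_algebra"
  assume XY: "cauchy_rel X Y"
  have "(\<lambda>n. max_norm (Y n) - max_norm (X n)) \<longlonglongrightarrow> 0"
  proof (rule Lim_null_comparison[OF always_eventually])
    show "\<forall>n. norm (max_norm (Y n) - max_norm (X n)) \<le> max_norm (X n - Y n)"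
      unfolding real_norm_def abs_minus_commute[of "max_norm (Y _)"] by (intro allI max_norm_diff_abs)
    show "(\<lambda>n. max_norm (X n - Y n)) \<longlonglongrightarrow> 0"
      using XY by (simp add: cauchy_rel_def)
  qed
  moreover have "(\<lambda>n. max_norm (X n)) \<longlonglongrightarrow> lim (\<lambda>n. max_norm (X n))"
    using XY by (simp add: cauchy_rel_def ga_cauchy_norm_LIMSEQ)
  ultimately have "(\<lambda>n. max_norm (Y n)) \<longlonglongrightarrow> lim (\<lambda>n. max_norm (X n))"
    using tendsto_add by fastforce
  then show "lim (\<lambda>n. max_norm (X n)) = lim (\<lambda>n. max_norm (Y n))"
    by (simp add: limI)
qed

lift_definition scaleR_group_cstar :: "real \<Rightarrow> 'a group_cstar \<Rightarrow> 'a group_cstar"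
  is "\<lambda>r X n. ga_scale (complex_of_real r) (X n)"
  by (rule cauchy_rel_scale)

definition sgn_group_cstar :: "'a group_cstar \<Rightarrow> 'a group_cstar" where
  "sgn_group_cstar x = inverse (norm x) *\<^sub>R x"

definition dist_group_cstar :: "'a group_cstar \<Rightarrow> 'a group_cstar \<Rightarrow> real" where
  "dist_group_cstar x y = norm (x - y)"

definition uniformity_group_cstar :: "('a group_cstar \<times> 'a group_cstar) filter" where
  "uniformity_group_cstar = (INF e\<in>{0<..}. principal {(x, y). dist x y < e})"

definition open_group_cstar :: "'a group_cstar set \<Rightarrow> bool" where
  "open_group_cstar S \<longleftrightarrow> (\<forall>x\<in>S. \<forall>\<^sub>F (x', y) in uniformity. x' = x \<longrightarrow> y \<in> S)"

instance
proof
  fix x y z :: "'a group_cstar" and r s :: real and S :: "'a group_cstar set"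
  show "r *\<^sub>R (x + y) = r *\<^sub>R x + r *\<^sub>R y" "(r + s) *\<^sub>R x = r *\<^sub>R x + s *\<^sub>R x"
    "r *\<^sub>R s *\<^sub>R x = (r * s) *\<^sub>R x" "1 *\<^sub>R x = x"
    "r *\<^sub>R x * y = r *\<^sub>R (x * y)" "x * r *\<^sub>R y = r *\<^sub>R (x * y)"
    by (transfer; simp add: cauchy_rel_def ga_scale_add ga_scale_add_left ga_scale_scale
        ga_scale_mult_left ga_scale_mult_right)+
  show "sgn x = inverse (norm x) *\<^sub>R x" "dist x y = norm (x - y)"
    "uniformity = (INF e\<in>{0<..}. principal {(x, y :: 'a group_cstar). dist x y < e})"
    "open S \<longleftrightarrow> (\<forall>x\<in>S. \<forall>\<^sub>F (x', y) in uniformity. x' = x \<longrightarrow> y \<in> S)"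
    by (simp_all only: sgn_group_cstar_def dist_group_cstar_def uniformity_group_cstar_def
        open_group_cstar_def)
  show "norm (1 :: 'a group_cstar) = 1"
    by transfer simp
  show "(norm x = 0) = (x = 0)"
  proof transfer
    fix X :: "nat \<Rightarrow> 'a group_algebra"
    assume "cauchy_rel X X"
    then show "(lim (\<lambda>n. max_norm (X n)) = 0) = cauchy_rel X (\<lambda>n. 0)"
      using ga_cauchy_norm_LIMSEQ[of X] limI[of "\<lambda>n. max_norm (X n)" 0]
      by (auto simp: cauchy_rel_def)
  qed
  show "norm (x + y) \<le> norm x + norm y"
  proof transfer
    fix X Y :: "nat \<Rightarrow> 'a group_algebra"
    assume "cauchy_rel X X" "cauchy_rel Y Y"
    then show "lim (\<lambda>n. max_norm (X n + Y n)) \<le> lim (\<lambda>n. max_norm (X n)) + lim (\<lambda>n. max_norm (Y n))"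
      by (intro LIMSEQ_le[OF ga_cauchy_norm_LIMSEQ tendsto_add[OF ga_cauchy_norm_LIMSEQ
            ga_cauchy_norm_LIMSEQ]]) (auto simp: cauchy_rel_def max_norm_add)
  qed
  show "norm (x * y) \<le> norm x * norm y"
  proof transfer
    fix X Y :: "nat \<Rightarrow> 'a group_algebra"
    assume "cauchy_rel X X" "cauchy_rel Y Y"
    then show "lim (\<lambda>n. max_norm (X n * Y n)) \<le> lim (\<lambda>n. max_norm (X n)) * lim (\<lambda>n. max_norm (Y n))"
      by (intro LIMSEQ_le[OF ga_cauchy_norm_LIMSEQ tendsto_mult[OF ga_cauchy_norm_LIMSEQ
            ga_cauchy_norm_LIMSEQ]]) (auto simp: cauchy_rel_def max_norm_mult)
  qed
  show "norm (r *\<^sub>R x) = \<bar>r\<bar> * norm x"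
  proof transfer
    fix r and X :: "nat \<Rightarrow> 'a group_algebra"
    assume "cauchy_rel X X"
    then show "lim (\<lambda>n. max_norm (ga_scale (complex_of_real r) (X n))) = \<bar>r\<bar> * lim (\<lambda>n. max_norm (X n))"
      by (intro limI) (auto simp: cauchy_rel_def max_norm_scale intro!: tendsto_mult_left
          ga_cauchy_norm_LIMSEQ)
  qed
qed

end

definition of_group_algebra :: "'g::group_add group_algebra \<Rightarrow> 'g group_cstar" where
  "of_group_algebra x = abs_group_cstar (\<lambda>n. x)"

lemma norm_of_group_algebra: "norm (of_group_algebra x) = max_norm x"
  by (simp add: of_group_algebra_def norm_group_cstar.abs_eq cauchy_rel_refl)

lemma of_group_algebra_diff: "of_group_algebra (x - y) = of_group_algebra x - of_group_algebra y"
  by (simp add: of_group_algebra_def minus_group_cstar.abs_eq cauchy_rel_refl)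

lemma abs_group_cstar_LIMSEQ:
  assumes "ga_cauchy X"
  shows "(\<lambda>n. of_group_algebra (X n)) \<longlonglongrightarrow> abs_group_cstar X"
proof (rule LIMSEQ_I)
  fix e :: real
  assume "e > 0"
  then obtain N where N: "\<forall>m\<ge>N. \<forall>n\<ge>N. max_norm (X m - X n) < e / 2"
    using assms unfolding ga_cauchy_def by (meson half_gt_zero)
  have "norm (of_group_algebra (X m) - abs_group_cstar X) < e" if "m \<ge> N" for m
  proof -
    have "of_group_algebra (X m) - abs_group_cstar X = abs_group_cstar (\<lambda>n. X m - X n)"
      using assms by (simp add: of_group_algebra_def minus_group_cstar.abs_eq cauchy_rel_refl)
    then have "norm (of_group_algebra (X m) - abs_group_cstar X) = lim (\<lambda>n. max_norm (X m - X n))"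
      using assms by (simp add: norm_group_cstar.abs_eq cauchy_rel_refl)
    also have "\<dots> \<le> e / 2"
      by (rule LIMSEQ_le_const2[OF ga_cauchy_norm_LIMSEQ])
         (use assms N that in \<open>auto intro!: exI[of _ N] less_imp_le\<close>)
    finally show ?thesis
      using \<open>e > 0\<close> by simp
  qed
  then show "\<exists>N. \<forall>m\<ge>N. norm (of_group_algebra (X m) - abs_group_cstar X) < e"
    by blast
qed

lemma of_group_algebra_dense:
  assumes "e > 0"
  shows "\<exists>x. norm (a - of_group_algebra x) < e"
proof (induction a rule: group_cstar.abs_induct)
  case (1 X)
  then have "(\<lambda>n. of_group_algebra (X n)) \<longlonglongrightarrow> abs_group_cstar X"
    by (simp add: cauchy_rel_def abs_group_cstar_LIMSEQ)
  then show ?case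
    using assms by (metis LIMSEQ_D norm_minus_commute order.refl)
qed

instance group_cstar :: (group_add) complete_space
proof
  fix A :: "nat \<Rightarrow> 'a group_cstar"
  assume A: "Cauchy A"
  have "\<exists>x. norm (A n - of_group_algebra x) < inverse (real (Suc n))" for n
    by (rule of_group_algebra_dense) simp
  then obtain X where X: "\<And>n. norm (A n - of_group_algebra (X n)) < inverse (real (Suc n))"
    by metis
  have AX: "(\<lambda>n. A n - of_group_algebra (X n)) \<longlonglongrightarrow> 0"
    by (rule Lim_null_comparison[OF always_eventually LIMSEQ_inverse_real_of_nat])
       (use X less_imp_le in blast)
  have "Cauchy (\<lambda>n. of_group_algebra (X n))"
  proof (rule metric_CauchyI)
    fix e :: real
    assume "e > 0"
    then have e: "e / 3 > 0"
      by simp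
    obtain M where M: "\<forall>n\<ge>M. norm (A n - of_group_algebra (X n)) < e / 3"
      using LIMSEQ_D[OF AX e] by auto
    obtain N where N: "\<forall>m\<ge>N. \<forall>n\<ge>N. dist (A m) (A n) < e / 3"
      using metric_CauchyD[OF A e] by blast
    have "dist (of_group_algebra (X m)) (of_group_algebra (X n)) < e"
      if "m \<ge> max M N" "n \<ge> max M N" for m n
    proof -
      have "dist (of_group_algebra (X m)) (A m) < e / 3" "dist (A m) (A n) < e / 3"
        "dist (A n) (of_group_algebra (X n)) < e / 3"
        using M N that by (simp_all add: dist_norm norm_minus_commute[of _ "A m"])
      then show ?thesis
        using dist_triangle[of "of_group_algebra (X m)" "of_group_algebra (X n)" "A m"]
          dist_triangle[of "A m" "of_group_algebra (X n)" "A n"] by linarith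
    qed
    then show "\<exists>M. \<forall>m\<ge>M. \<forall>n\<ge>M. dist (of_group_algebra (X m)) (of_group_algebra (X n)) < e"
      by blast
  qed
  then have "ga_cauchy X"
    by (simp add: Cauchy_def ga_cauchy_def dist_norm norm_of_group_algebra
        flip: of_group_algebra_diff)
  then have "(\<lambda>n. (A n - of_group_algebra (X n)) + of_group_algebra (X n)) \<longlonglongrightarrow> 0 + abs_group_cstar X"
    by (intro tendsto_add AX abs_group_cstar_LIMSEQ)
  then show "convergent A"
    by (auto simp: convergent_def)
qed

instantiation group_cstar :: (group_add) cstar_algebra
begin

lift_definition scaleC_group_cstar :: "complex \<Rightarrow> 'a group_cstar \<Rightarrow> 'a group_cstar"
  is "\<lambda>c X n. ga_scale c (X n)"
  by (rule cauchy_rel_scale)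

lift_definition adj_group_cstar :: "'a group_cstar \<Rightarrow> 'a group_cstar" is "\<lambda>X n. ga_adj (X n)"
  by (rule cauchy_rel_adj)

instance
proof
  fix x y :: "'a group_cstar" and c d :: complex and r :: real
  show "c *\<^sub>C (x + y) = c *\<^sub>C x + c *\<^sub>C y" "(c + d) *\<^sub>C x = c *\<^sub>C x + d *\<^sub>C x"
    "c *\<^sub>C d *\<^sub>C x = (c * d) *\<^sub>C x" "complex_of_real r *\<^sub>C x = r *\<^sub>R x"
    "c *\<^sub>C x * y = c *\<^sub>C (x * y)" "x * c *\<^sub>C y = c *\<^sub>C (x * y)"
    "adj (adj x) = x" "adj (x + y) = adj x + adj y" "adj (c *\<^sub>C x) = cnj c *\<^sub>C adj x"
    "adj (x * y) = adj y * adj x"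
    by (transfer; simp add: cauchy_rel_def ga_scale_add ga_scale_add_left ga_scale_scale
        ga_scale_mult_left ga_scale_mult_right ga_adj_adj ga_adj_add ga_adj_scale ga_adj_mult)+
  show "norm (c *\<^sub>C x) = cmod c * norm x"
  proof transfer
    fix c and X :: "nat \<Rightarrow> 'a group_algebra"
    assume "cauchy_rel X X"
    then show "lim (\<lambda>n. max_norm (ga_scale c (X n))) = cmod c * lim (\<lambda>n. max_norm (X n))"
      by (intro limI) (auto simp: cauchy_rel_def max_norm_scale intro!: tendsto_mult_left
          ga_cauchy_norm_LIMSEQ)
  qed
  show "norm (adj x * x) = (norm x)\<^sup>2"
  proof transfer
    fix X :: "nat \<Rightarrow> 'a group_algebra"
    assume "cauchy_rel X X"
    then show "lim (\<lambda>n. max_norm (ga_adj (X n) * X n)) = (lim (\<lambda>n. max_norm (X n)))\<^sup>2"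
      by (intro limI) (auto simp: cauchy_rel_def max_norm_cstar intro!: tendsto_power
          ga_cauchy_norm_LIMSEQ)
  qed
qed

end

lift_definition canonical_unitary :: "'g::group_add \<Rightarrow> 'g group_cstar"
  is "\<lambda>w n. Poly_Mapping.single w 1"
  by (simp add: cauchy_rel_refl)

lemma canonical_unitary_add:
  "canonical_unitary (u + v) = canonical_unitary u * canonical_unitary v"
  by transfer (simp add: cauchy_rel_def mult_single)

lemma canonical_unitary_zero: "canonical_unitary 0 = 1"
  by transfer (simp add: cauchy_rel_def)

lemma adj_canonical_unitary: "adj (canonical_unitary w) = canonical_unitary (- w)"
  by transfer (simp add: cauchy_rel_def)


section \<open>Symmetric states on the C*-algebra of a free group\<close>

lemma max_norm_permute_diff:
  "max_norm (ga_map (permute_word \<sigma>) x - ga_map (permute_word \<sigma>) y) \<le> 1 * max_norm (x - y)"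
  using max_norm_ga_map_le[of "permute_word \<sigma>" "x - y", OF permute_word_add]
  by (simp add: ga_map_diff)

lemmas ga_cauchy_permute [simp] =
    ga_cauchy_lipschitz[where F = "ga_map (permute_word \<sigma>)" for \<sigma>, OF _ max_norm_permute_diff]
  and cauchy_rel_permute =
    cauchy_rel_lipschitz[where F = "ga_map (permute_word \<sigma>)" for \<sigma>, OF _ max_norm_permute_diff]

lift_definition perm_aut :: "'i perm \<Rightarrow> 'i free_group group_cstar \<Rightarrow> 'i free_group group_cstar"
  is "\<lambda>\<sigma> X n. ga_map (permute_word \<sigma>) (X n)"
  by (rule cauchy_rel_permute)

lemma perm_aut_generator:
  "perm_aut \<sigma> (canonical_unitary (generator i)) = canonical_unitary (generator (Perm.apply \<sigma> i))"
  by transfer (simp add: cauchy_rel_def permute_word_generator)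

lemma perm_aut_add: "perm_aut \<sigma> (a + b) = perm_aut \<sigma> a + perm_aut \<sigma> b"
  by transfer (simp add: cauchy_rel_def ga_map_add)

lemma perm_aut_mult: "perm_aut \<sigma> (a * b) = perm_aut \<sigma> a * perm_aut \<sigma> b"
  by transfer (simp add: cauchy_rel_def ga_map_mult permute_word_add)

lemma perm_aut_scaleC: "perm_aut \<sigma> (c *\<^sub>C a) = c *\<^sub>C perm_aut \<sigma> a"
  by transfer (simp add: cauchy_rel_def ga_map_scale)

lemma perm_aut_adj: "perm_aut \<sigma> (adj a) = adj (perm_aut \<sigma> a)"
  by transfer (simp add: cauchy_rel_def ga_map_adj permute_word_uminus)

definition symmetric_states :: "('i free_group group_cstar \<Rightarrow>\<^sub>L complex) set" where
  "symmetric_states = {\<phi> \<in> states. \<forall>\<sigma> a. blinfun_apply \<phi> (perm_aut \<sigma> a) = blinfun_apply \<phi> a}"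

text \<open>The set \<open>{\<sigma>. affected \<sigma> \<subseteq> I}\<close> is the group of the permutations that move only elements of \<open>I\<close>.\<close>

definition weakly_clustering :: "('i free_group group_cstar \<Rightarrow>\<^sub>L complex) \<Rightarrow> bool" where
  "weakly_clustering \<phi> \<longleftrightarrow> \<phi> \<in> symmetric_states \<and>
     (\<forall>A B. ((\<lambda>I. (\<Sum>\<sigma> | affected \<sigma> \<subseteq> I. blinfun_apply \<phi> (perm_aut \<sigma> A * B))
                  / of_nat (card {\<sigma> :: 'i perm. affected \<sigma> \<subseteq> I}))
        \<longlongrightarrow> blinfun_apply \<phi> A * blinfun_apply \<phi> B) (finite_subsets_at_top UNIV))"

text \<open>At most one state takes these values, as the canonical unitaries span a dense subspace; that there
  is one for every positive parameter is a theorem of Haagerup.\<close>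

definition haagerup_state :: "real \<Rightarrow> int free_group group_cstar \<Rightarrow>\<^sub>L complex" where
  "haagerup_state l = (THE \<phi>. \<phi> \<in> states \<and>
     (\<forall>w. blinfun_apply \<phi> (canonical_unitary w) = of_real (exp (- l * real (word_length w)))))"

end

theory Submission
  imports Defs
begin

text \<open>Haagerup's theorem is proved through the Cayley tree. The distance \<open>\<bar>u\<^sup>-\<^sup>1 v\<bar>\<close> of two words is the
  number of edges that lie on exactly one of the paths from the root to \<open>u\<close> and to \<open>v\<close>
  (\<open>word_length_diff\<close>), and for \<open>0 \<le> r \<le> 1\<close> the power of \<open>r\<close> to the size of a symmetric difference is
  a combination of products of signs with nonnegative coefficients (\<open>pow_card_symdiff\<close>). So
  \<open>exp (- l \<bar>w\<bar>)\<close> is a positive definite function of \<open>w\<close>. The operator norm of its GNS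
  representation is a C*-seminorm on the group algebra, so the corresponding functional is bounded by
  the largest one (\<open>ga_eval_le_max_norm\<close>) and extends to a state on the completion.

  A random permutation of a large finite set moves the generators that occur in \<open>u\<close> away from those
  in \<open>v\<close> with a probability close to one, and then \<open>\<bar>\<sigma>(u) v\<bar> = \<bar>u\<bar> + \<bar>v\<bar>\<close>. This is weak clustering for
  group elements (\<open>perm_average_tendsto\<close>, \<open>word_length_add_disjoint\<close>); bilinearity and density do the
  rest.

  Extremality holds for every weakly clustering state \<open>\<phi>\<close>. If \<open>\<phi> A = 0\<close>, the averages \<open>A\<^sub>I\<close> of the
  images of \<open>A\<close> under the permutations on \<open>I\<close> satisfy \<open>\<phi> (A\<^sub>I\<^sup>* A\<^sub>I) \<longlonglongrightarrow> \<bar>\<phi> A\<bar>\<^sup>2 = 0\<close>. A symmetric state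
  \<open>\<psi>\<close>, some positive multiple of which is below \<open>\<phi>\<close>, satisfies
  \<open>\<bar>\<psi> A\<bar>\<^sup>2 = \<bar>\<psi> A\<^sub>I\<bar>\<^sup>2 \<le> \<psi> (A\<^sub>I\<^sup>* A\<^sub>I)\<close>. Hence \<open>\<psi>\<close> vanishes wherever \<open>\<phi>\<close> does, and \<open>\<psi> = \<phi>\<close>
  (\<open>weakly_clustering_dominates\<close>); both parts of a convex decomposition of \<open>\<phi>\<close> are such states.\<close>


section \<open>Word length as the number of separating edges\<close>

text \<open>In the Cayley tree, the vertices met while the power \<open>g\<^sub>i\<^sup>k\<close> is appended to a word \<open>p\<close> are
  \<open>p g\<^sub>i\<^sup>m\<close> with \<open>m\<close> between \<open>0\<close> and \<open>k\<close>; the edge from \<open>m\<close> to \<open>m + 1\<close> is encoded by \<open>m\<close>, whatever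
  the sign of \<open>k\<close>. Hence powers of equal sign share the edges of the shorter one, and powers of
  opposite sign share none.\<close>

definition block_edges :: "int \<Rightarrow> int set" where
  "block_edges k = {min 0 k..<max 0 k}"

text \<open>An edge on the path from the empty word to \<open>w\<close> carries the full syllables that precede it, so
  equal triples from different words denote the same edge of the tree.\<close>

fun path_edges :: "('i \<times> int) list \<Rightarrow> (('i \<times> int) list \<times> 'i \<times> int) set" where
  "path_edges [] = {}"
| "path_edges ((i, k) # w) =
     (\<lambda>m. ([], i, m)) ` block_edges k \<union> (\<lambda>(p, e). ((i, k) # p, e)) ` path_edges w"

lemma finite_path_edges [simp]: "finite (path_edges w)"
  by (induction w rule: path_edges.induct) (auto simp: block_edges_def)

abbreviation list_length :: "('i \<times> int) list \<Rightarrow> nat" where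
  "list_length w \<equiv> (\<Sum>(i, k)\<leftarrow>w. nat \<bar>k\<bar>)"

lemma card_block_union:
  assumes "finite A" "finite B"
  shows "card ((\<lambda>m. ([], i, m)) ` A \<union> (\<lambda>(p, e). (s # p, e)) ` B) = card A + card B"
proof -
  have "card ((\<lambda>m. ([], i, m)) ` A \<union> (\<lambda>(p, e). (s # p, e)) ` B)
      = card ((\<lambda>m. ([] :: 'b list, i, m)) ` A) + card ((\<lambda>(p, e). (s # p, e)) ` B)"
    by (rule card_Un_disjoint) (use assms in auto)
  also have "\<dots> = card A + card B"
    by (intro arg_cong2[where f = "(+)"] card_image) (auto simp: inj_on_def)
  finally show ?thesis .
qed

lemma card_path_edges: "card (path_edges w) = list_length w"
proof (induction w rule: path_edges.induct)
  case (2 i k w)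
  have "card (path_edges ((i, k) # w)) = card (block_edges k) + card (path_edges w)"
    unfolding path_edges.simps by (rule card_block_union) (auto simp: block_edges_def)
  then show ?case
    using 2 by (simp add: block_edges_def max_def min_def)
qed simp

lemma card_symdiff_block: "card (sym_diff (block_edges k) (block_edges l)) = nat \<bar>l - k\<bar>"
proof -
  have "sym_diff (block_edges k) (block_edges l) = {min k l..<max k l}"
    by (auto simp: block_edges_def)
  then show ?thesis
    by auto
qed

lemma list_length_inv: "list_length (word_inv u) = list_length u"
  by (induction u) (auto simp: word_inv_def)

lemma word_mult_reduced_append: "reduced (a @ b) \<Longrightarrow> word_mult a b = a @ b"
proof (induction a)
  case (Cons s a)
  then show ?case
    by (cases s) (simp add: reduced_Cons push_reduced)
qed simp

lemma reduced_append:
  "reduced (a @ b) \<longleftrightarrow> reduced a \<and> reduced b \<and> (a \<noteq> [] \<longrightarrow> b \<noteq> [] \<longrightarrow> fst (last a) \<noteq> fst (hd b))"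
  unfolding reduced_def successively_append_iff by auto

lemma reduced_inv_append:
  assumes "reduced ((i, k) # u)" "reduced ((i, l) # v)"
  shows "reduced (word_inv u @ (i, l) # v)"
  unfolding reduced_append using assms
  by (cases u) (auto simp: reduced_word_inv reduced_Cons, auto simp: word_inv_def)

text \<open>An edge of the Cayley tree separates two vertices exactly if it lies on one, but not both, of
  the paths from the root. Below the longest common prefix nothing cancels, except that two different
  powers of the same generator may still share a piece of their path.\<close>

lemma list_length_inv_mult:
  assumes "reduced u" "reduced v"
  shows "list_length (word_mult (word_inv u) v) = card (sym_diff (path_edges u) (path_edges v))"
  using assms
proof (induction u arbitrary: v)
  case Nil
  then show ?case
    by (simp add: word_inv_def card_path_edges)
next
  case (Cons s u)
  obtain i k where s: "s = (i, k)"
    by force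
  have u: "reduced u" "k \<noteq> 0"
    using Cons.prems by (auto simp: s reduced_Cons)
  have inv: "word_mult (word_inv (s # u)) v = word_mult (word_inv u) (push i (- k) v)"
    by (simp add: s word_inv_def word_mult_append)
  show ?case
  proof (cases v)
    case Nil
    then show ?thesis
      using Cons.prems by (simp add: card_path_edges word_mult_Nil_right reduced_word_inv list_length_inv)
  next
    case v: (Cons t v')
    obtain j l where t: "t = (j, l)"
      by force
    have v': "reduced v'" "l \<noteq> 0"
      using Cons.prems by (auto simp: v t reduced_Cons)
    consider "s = t" | "i = j" "k \<noteq> l" | "i \<noteq> j"
      using s t by blast
    then show ?thesis
    proof cases
      case 1
      have "push i (- k) v = v'"
        using 1 v' u s by (auto simp: v)
      moreover have "sym_diff (path_edges (s # u)) (path_edges v)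
          = (\<lambda>(p, e). (s # p, e)) ` sym_diff (path_edges u) (path_edges v')"
        unfolding s v 1[symmetric] by auto
      moreover have "inj (\<lambda>(p, e :: 'a \<times> int). (s # p, e))"
        by (auto simp: inj_def)
      ultimately show ?thesis
        using inv Cons.IH[OF u(1) v'(1)] by (simp add: card_image inj_on_subset)
    next
      case 2
      have "reduced ((i, l - k) # v')"
        using Cons.prems 2 by (auto simp: v t reduced_Cons)
      then have "word_mult (word_inv u) (push i (- k) v) = word_inv u @ (i, l - k) # v'"
        using 2 u Cons.prems
        by (simp add: v t s word_mult_reduced_append reduced_inv_append)
      moreover have "sym_diff (path_edges (s # u)) (path_edges v)
          = (\<lambda>m. ([], i, m)) ` sym_diff (block_edges k) (block_edges l) \<union>
            ((\<lambda>(p, e). (s # p, e)) ` path_edges u \<union> (\<lambda>(p, e). (t # p, e)) ` path_edges v')"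
        using 2 unfolding s v t by auto
      moreover have "card \<dots> = nat \<bar>l - k\<bar> + (card (path_edges u) + card (path_edges v'))"
      proof -
        let ?U = "(\<lambda>m. ([] :: ('a \<times> int) list, i, m)) ` sym_diff (block_edges k) (block_edges l)"
          and ?V = "(\<lambda>(p, e). (s # p, e)) ` path_edges u" and ?W = "(\<lambda>(p, e). (t # p, e)) ` path_edges v'"
        have "finite ?U"
          by (simp add: block_edges_def)
        moreover have "?U \<inter> (?V \<union> ?W) = {}" "?V \<inter> ?W = {}"
          using 2 s t by auto
        ultimately have "card (?U \<union> (?V \<union> ?W)) = card ?U + (card ?V + card ?W)"
          by (simp add: card_Un_disjoint)
        also have "\<dots> = nat \<bar>l - k\<bar> + (card (path_edges u) + card (path_edges v'))"
          by (subst (1 2 3) card_image) (auto simp: inj_on_def card_symdiff_block)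
        finally show ?thesis .
      qed
      ultimately show ?thesis
        using inv by (simp add: card_path_edges list_length_inv)
    next
      case 3
      have "reduced ((i, - k) # v)"
        using Cons.prems 3 u by (auto simp: v t reduced_Cons)
      then have "word_mult (word_inv u) (push i (- k) v) = word_inv u @ (i, - k) # v"
        using 3 u Cons.prems
        by (simp add: push_reduced word_mult_reduced_append reduced_inv_append s)
      moreover have "path_edges (s # u) \<inter> path_edges v = {}"
        using 3 unfolding s v t by auto
      then have "card (sym_diff (path_edges (s # u)) (path_edges v))
          = card (path_edges (s # u)) + card (path_edges v)"
        by (simp add: Diff_triv Int_commute card_Un_disjoint)
      ultimately show ?thesis
        using inv by (simp add: card_path_edges list_length_inv s del: path_edges.simps)
    qed
  qed
qed

definition edges :: "'i free_group \<Rightarrow> (('i \<times> int) list \<times> 'i \<times> int) set" where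
  "edges w = path_edges (syllables w)"

lemma finite_edges [simp]: "finite (edges w)"
  by (simp add: edges_def)

lemma word_length_diff: "word_length (- u + v) = card (sym_diff (edges u) (edges v))"
  unfolding edges_def by transfer (rule list_length_inv_mult)


section \<open>The kernel given by the size of a symmetric difference\<close>

text \<open>Both sides factor over the elements \<open>e\<close> of \<open>\<Omega>\<close>: if \<open>\<epsilon>\<^sub>A(e)\<close> is \<open>-1\<close> for \<open>e\<close> in \<open>A\<close> and
  \<open>1\<close> otherwise, the factor, \<open>1\<close> or \<open>r\<close>, is \<open>(1 + r) / 2 + (1 - r) / 2 * \<epsilon>\<^sub>A(e) \<epsilon>\<^sub>B(e)\<close>. Multiplying
  out exhibits the kernel as a combination of products of a function of \<open>A\<close> and the same function
  of \<open>B\<close>, with coefficients that are nonnegative for \<open>\<bar>r\<bar> \<le> 1\<close>; this is what makes it positive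
  definite.\<close>

lemma pow_card_symdiff:
  fixes r :: real
  assumes "finite \<Omega>" "A \<subseteq> \<Omega>" "B \<subseteq> \<Omega>"
  shows "r ^ card (sym_diff A B) = (\<Sum>S\<in>Pow \<Omega>.
    ((1 - r) / 2) ^ card S * ((1 + r) / 2) ^ card (\<Omega> - S) * ((-1) ^ card (S \<inter> A) * (-1) ^ card (S \<inter> B)))"
proof -
  define \<epsilon> :: "'a set \<Rightarrow> 'a \<Rightarrow> real" where "\<epsilon> A e = (if e \<in> A then -1 else 1)" for A e
  have sign: "(\<Prod>e\<in>S. \<epsilon> A e) = (-1) ^ card (S \<inter> A)" if "S \<subseteq> \<Omega>" for S A
  proof -
    have "finite S"
      using that assms(1) finite_subset by blast
    then show ?thesis
      unfolding \<epsilon>_def by (simp add: prod.If_cases)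
  qed
  have pow: "r ^ card D = (\<Prod>e\<in>\<Omega>. if e \<in> D then r else 1)" if "D \<subseteq> \<Omega>" for D
    using assms(1) that by (simp add: prod.If_cases Int_absorb1)
  have "r ^ card (sym_diff A B) = (\<Prod>e\<in>\<Omega>. if e \<in> sym_diff A B then r else 1)"
    by (rule pow) (use assms(2,3) in blast)
  also have "\<dots> = (\<Prod>e\<in>\<Omega>. (1 - r) / 2 * (\<epsilon> A e * \<epsilon> B e) + (1 + r) / 2)"
  proof (rule prod.cong[OF refl])
    have h: "(1 - r) / 2 + (1 + r) / 2 = 1" "- ((1 - r) / 2) + (1 + r) / 2 = r"
      by (simp_all add: field_simps)
    show "(if e \<in> sym_diff A B then r else 1) = (1 - r) / 2 * (\<epsilon> A e * \<epsilon> B e) + (1 + r) / 2" for e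
      using h unfolding \<epsilon>_def by (cases "e \<in> A"; cases "e \<in> B") simp_all
  qed
  also have "\<dots> = (\<Sum>S\<in>Pow \<Omega>. (\<Prod>e\<in>S. (1 - r) / 2 * (\<epsilon> A e * \<epsilon> B e)) * (\<Prod>e\<in>\<Omega> - S. (1 + r) / 2))"
    by (rule prod_add[OF assms(1)])
  also have "\<dots> = (\<Sum>S\<in>Pow \<Omega>.
    ((1 - r) / 2) ^ card S * ((1 + r) / 2) ^ card (\<Omega> - S) * ((-1) ^ card (S \<inter> A) * (-1) ^ card (S \<inter> B)))"
  proof (rule sum.cong[OF refl])
    fix S
    assume "S \<in> Pow \<Omega>"
    then have "S \<subseteq> \<Omega>"
      by simp
    from sign[OF this] show "(\<Prod>e\<in>S. (1 - r) / 2 * (\<epsilon> A e * \<epsilon> B e)) * (\<Prod>e\<in>\<Omega> - S. (1 + r) / 2) =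
        ((1 - r) / 2) ^ card S * ((1 + r) / 2) ^ card (\<Omega> - S) * ((-1) ^ card (S \<inter> A) * (-1) ^ card (S \<inter> B))"
      by (simp only: prod.distrib prod_constant mult_ac)
  qed
  finally show ?thesis .
qed


section \<open>Positive sesquilinear forms\<close>

text \<open>The Cauchy-Schwarz inequality is used for functionals on the group algebra and for states on a
  C*-algebra; their common setting is a complex vector space with a possibly degenerate form.\<close>

locale positive_form =
  fixes scale :: "complex \<Rightarrow> 'v::ab_group_add \<Rightarrow> 'v" and B :: "'v \<Rightarrow> 'v \<Rightarrow> complex"
  assumes add_left: "B (x + y) z = B x z + B y z"
    and add_right: "B x (y + z) = B x y + B x z"
    and scale_left: "B (scale c x) y = cnj c * B x y"
    and scale_right: "B x (scale c y) = c * B x y"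
    and nonneg: "B x x \<in> \<real>\<^sub>\<ge>\<^sub>0"
begin

definition N :: "'v \<Rightarrow> real" where
  "N x = sqrt (Re (B x x))"

lemma N_nonneg [simp]: "0 \<le> N x"
  using nonneg[of x] by (simp add: N_def complex_nonneg_Reals_iff)

lemma N_square: "(N x)\<^sup>2 = Re (B x x)"
  using nonneg[of x] by (simp add: N_def complex_nonneg_Reals_iff)

lemma N_square_complex: "complex_of_real ((N x)\<^sup>2) = B x x"
  using nonneg[of x] by (simp add: N_square complex_eq_iff complex_nonneg_Reals_iff)

lemma hermitian: "B y x = cnj (B x y)"
proof -
  have im: "Im (B z z) = 0" for z
    using nonneg[of z] by (simp add: complex_nonneg_Reals_iff)
  have "Im (B x y) + Im (B y x) = 0"
    using im[of "x + y"] im[of x] im[of y] by (simp add: add_left add_right)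
  moreover have "Re (B x y) - Re (B y x) = 0"
    using im[of "x + scale \<i> y"] im[of x] im[of y]
    by (simp add: add_left add_right scale_left scale_right)
  ultimately show ?thesis
    by (simp add: complex_eq_iff)
qed

lemma Cauchy_Schwarz: "cmod (B x y) \<le> N x * N y"
proof -
  define b where "b = (cmod (B x y))\<^sup>2"
  have b: "B x y * cnj (B x y) = of_real b" "cnj (B x y) * B x y = of_real b"
    by (simp_all add: b_def complex_norm_square[symmetric] mult.commute)
  \<comment> \<open>This is \<open>B (x - t c y) (x - t c y)\<close> with \<open>c\<close> the conjugate of \<open>B x y\<close>, which makes the cross
    terms real.\<close>
  have *: "0 \<le> (N x)\<^sup>2 - 2 * t * b + t\<^sup>2 * b * (N y)\<^sup>2" for t :: real
  proof -
    let ?z = "x + scale (- of_real t * cnj (B x y)) y"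
    have "B ?z ?z = B x x - of_real t * (cnj (B x y) * B x y) - of_real t * (B x y * cnj (B x y))
        + of_real (t\<^sup>2) * (B x y * cnj (B x y)) * B y y"
      by (simp add: add_left add_right scale_left scale_right hermitian[of y x] algebra_simps
          power2_eq_square)
    also have "\<dots> = of_real ((N x)\<^sup>2 - 2 * t * b + t\<^sup>2 * b * (N y)\<^sup>2)"
      unfolding b N_square_complex[symmetric] by simp
    finally have "Re (B ?z ?z) = (N x)\<^sup>2 - 2 * t * b + t\<^sup>2 * b * (N y)\<^sup>2"
      by (metis Re_complex_of_real)
    then show ?thesis
      by (metis N_square zero_le_power2)
  qed
  have "b \<le> (N x)\<^sup>2 * (N y)\<^sup>2"
  proof (cases "N y = 0")
    case True
    have "b = 0"
    proof (rule ccontr)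
      assume "b \<noteq> 0"
      then show False
        using *[of "((N x)\<^sup>2 + 1) / (2 * b)"] True by simp
    qed
    then show ?thesis
      by simp
  next
    case False
    then have "0 \<le> (N x)\<^sup>2 - b / (N y)\<^sup>2"
      using *[of "1 / (N y)\<^sup>2"] by (simp add: power2_eq_square field_simps)
    then show ?thesis
      using False by (simp add: field_simps)
  qed
  then show ?thesis
    unfolding b_def power_mult_distrib[symmetric] by (rule power2_le_imp_le) simp
qed

lemma N_add: "N (x + y) \<le> N x + N y"
proof (rule power2_le_imp_le)
  have "(N (x + y))\<^sup>2 = (N x)\<^sup>2 + 2 * Re (B x y) + (N y)\<^sup>2"
    by (simp add: N_square add_left add_right hermitian[of y x])
  also have "\<dots> \<le> (N x)\<^sup>2 + 2 * (N x * N y) + (N y)\<^sup>2"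
    using order_trans[OF complex_Re_le_cmod Cauchy_Schwarz[of x y]] by simp
  finally show "(N (x + y))\<^sup>2 \<le> (N x + N y)\<^sup>2"
    by (simp add: power2_sum)
qed simp

lemma N_scale: "N (scale c x) = cmod c * N x"
proof -
  have "B (scale c x) (scale c x) = of_real ((cmod c * N x)\<^sup>2)"
    unfolding scale_left scale_right power_mult_distrib of_real_mult N_square_complex
      complex_norm_square by (simp only: mult_ac)
  then have "(N (scale c x))\<^sup>2 = (cmod c * N x)\<^sup>2"
    unfolding N_square by (metis Re_complex_of_real)
  then show ?thesis
    by (rule power2_eq_imp_eq) simp_all
qed

end


section \<open>Positive definite functions on a group\<close>

definition ga_eval :: "('g \<Rightarrow> complex) \<Rightarrow> 'g group_algebra \<Rightarrow> complex" where
  "ga_eval f x = (\<Sum>w\<in>Poly_Mapping.keys x. Poly_Mapping.lookup x w * f w)"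

lemma ga_eval_add: "ga_eval f (x + y) = ga_eval f x + ga_eval f y"
  unfolding ga_eval_def by (rule ga_extend_add) (auto simp: distrib_right)

lemma ga_eval_single [simp]: "ga_eval f (Poly_Mapping.single w c) = c * f w"
  by (simp add: ga_eval_def)

lemma ga_eval_0 [simp]: "ga_eval f 0 = 0"
  by (simp add: ga_eval_def)

lemma ga_eval_sum: "ga_eval f (sum g A) = (\<Sum>a\<in>A. ga_eval f (g a))"
  by (induction A rule: infinite_finite_induct) (simp_all add: ga_eval_add)

lemma ga_eval_scale: "ga_eval f (ga_scale c x) = c * ga_eval f x"
  by (induction x rule: ga_induct) (auto simp: ga_eval_add ga_scale_add distrib_left)

lemma ga_eval_diff: "ga_eval f (x - y) = ga_eval f x - ga_eval f y"
  by (metis add_diff_cancel diff_add_cancel ga_eval_add)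

lemma sum_single_lookup: "(\<Sum>w\<in>Poly_Mapping.keys x. Poly_Mapping.single w (Poly_Mapping.lookup x w)) = x"
  by (rule poly_mapping_eqI)
     (auto simp: lookup_sum lookup_single when_def in_keys_iff sum.delta)

lemma ga_eval_adj_mult:
  "ga_eval f (ga_adj x * y) = (\<Sum>u\<in>Poly_Mapping.keys x. \<Sum>v\<in>Poly_Mapping.keys y.
     cnj (Poly_Mapping.lookup x u) * Poly_Mapping.lookup y v * f (- u + v))"
proof -
  have "ga_adj x * y = (\<Sum>u\<in>Poly_Mapping.keys x. \<Sum>v\<in>Poly_Mapping.keys y.
      Poly_Mapping.single (- u + v) (cnj (Poly_Mapping.lookup x u) * Poly_Mapping.lookup y v))"
    by (subst (1) sum_single_lookup[of y, symmetric])
       (simp add: ga_adj_def sum_product mult_single)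
  then show ?thesis
    by (simp add: ga_eval_sum)
qed

text \<open>Such an \<open>f\<close> makes \<open>f (y\<^sup>* x)\<close> a positive form on the group algebra, and left multiplication acts on
  it by bounded operators: this is the GNS construction without passing to the quotient and the
  completion, as only the operator norm is needed.\<close>

locale positive_definite =
  fixes f :: "'g::group_add \<Rightarrow> complex"
  assumes ga_eval_nonneg: "ga_eval f (ga_adj x * x) \<in> \<real>\<^sub>\<ge>\<^sub>0"
    and normalized: "f 0 = 1"
begin

sublocale positive_form ga_scale "\<lambda>x y. ga_eval f (ga_adj x * y)"
  by standard
     (simp_all add: ga_adj_add ga_adj_scale distrib_left distrib_right ga_eval_add ga_eval_scale
       ga_scale_mult_left ga_scale_mult_right ga_eval_nonneg)

lemma N_single_mult: "N (Poly_Mapping.single w c * x) = cmod c * N x"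
proof -
  have "ga_adj (Poly_Mapping.single w c * x) * (Poly_Mapping.single w c * x)
      = ga_adj x * (Poly_Mapping.single (- w) (cnj c) * Poly_Mapping.single w c) * x"
    by (simp add: ga_adj_mult mult.assoc)
  also have "\<dots> = ga_adj (ga_scale c x) * ga_scale c x"
    by (simp add: mult_single ga_scale_scale ga_adj_scale ga_scale_mult_left ga_scale_mult_right mult.assoc mult.commute
        flip: ga_scale_def)
  finally show ?thesis
    unfolding N_scale[symmetric] by (simp add: N_def)
qed

text \<open>Group elements act isometrically, so the sum of the absolute values of the coefficients of \<open>x\<close> is a
  bound.\<close>

lemma N_mult_bounded: "\<exists>C. \<forall>y. N (x * y) \<le> C * N y"
proof (induction x rule: ga_induct)
  case zero
  show ?case
    by (rule exI[of _ 0]) (simp add: N_def)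
next
  case (single w c)
  show ?case
    using N_single_mult by (metis order.refl)
next
  case (add x y)
  then obtain a b where "\<forall>z. N (x * z) \<le> a * N z" "\<forall>z. N (y * z) \<le> b * N z"
    by blast
  then have "N ((x + y) * z) \<le> (a + b) * N z" for z
    using N_add[of "x * z" "y * z"] by (smt (verit) distrib_right)
  then show ?case
    by blast
qed

definition op_norm :: "'g group_algebra \<Rightarrow> real" where
  "op_norm x = (SUP y\<in>{y. N y \<le> 1}. N (x * y))"

lemma N_0 [simp]: "N 0 = 0"
  by (simp add: N_def)

lemma unit_ball_nonempty: "{y. N y \<le> 1} \<noteq> {}"
  by (auto intro!: exI[of _ 0])

lemma bdd_above_op_norm: "bdd_above ((\<lambda>y. N (x * y)) ` {y. N y \<le> 1})"
proof -
  obtain C where C: "\<And>y. N (x * y) \<le> C * N y"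
    using N_mult_bounded by blast
  have "N (x * y) \<le> \<bar>C\<bar>" if "N y \<le> 1" for y
    using C[of y] mult_mono[OF abs_ge_self that, of C] by simp
  then show ?thesis
    by (auto simp: bdd_above_def)
qed

lemma op_norm_nonneg: "0 \<le> op_norm x"
  unfolding op_norm_def by (rule cSUP_upper2[OF bdd_above_op_norm, of 0]) simp_all

text \<open>Vectors of length zero cannot be rescaled to unit length; they are sent to vectors of length zero
  because the action is bounded.\<close>

lemma N_mult_le: "N (x * y) \<le> op_norm x * N y"
proof (cases "N y = 0")
  case True
  obtain C where "N (x * y) \<le> C * N y"
    using N_mult_bounded by blast
  then show ?thesis
    using True by simp
next
  case False
  let ?c = "complex_of_real (inverse (N y))"
  have "N (x * ga_scale ?c y) \<le> op_norm x"
    unfolding op_norm_def by (rule cSUP_upper[OF _ bdd_above_op_norm]) (simp add: N_scale False norm_inverse)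
  then have "inverse (N y) * N (x * y) \<le> op_norm x"
    by (simp add: ga_scale_mult_right N_scale norm_inverse)
  then show ?thesis
    using False N_nonneg[of y] by (simp add: field_simps less_le)
qed

lemma op_norm_le:
  assumes "\<And>y. N (x * y) \<le> c * N y" "0 \<le> c"
  shows "op_norm x \<le> c"
  unfolding op_norm_def
proof (rule cSUP_least[OF unit_ball_nonempty])
  fix y
  assume "y \<in> {y. N y \<le> 1}"
  then have "c * N y \<le> c * 1"
    using assms(2) by (intro mult_left_mono) auto
  then show "N (x * y) \<le> c"
    using assms(1)[of y] by simp
qed

text \<open>\<open>\<parallel>x y\<parallel>\<^sup>2 = \<langle>y, x\<^sup>* x y\<rangle>\<close>, and Cauchy-Schwarz.\<close>

lemma op_norm_cstar_le: "(op_norm x)\<^sup>2 \<le> op_norm (ga_adj x * x)"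
proof -
  have "N (x * y) \<le> sqrt (op_norm (ga_adj x * x)) * N y" for y
  proof (rule power2_le_imp_le)
    have "(N (x * y))\<^sup>2 = Re (ga_eval f (ga_adj y * (ga_adj x * x * y)))"
      by (simp add: N_square ga_adj_mult mult.assoc)
    also have "\<dots> \<le> N y * N (ga_adj x * x * y)"
      using order_trans[OF complex_Re_le_cmod Cauchy_Schwarz] by blast
    also have "\<dots> \<le> N y * (op_norm (ga_adj x * x) * N y)"
      by (intro mult_left_mono N_mult_le) simp
    finally show "(N (x * y))\<^sup>2 \<le> (sqrt (op_norm (ga_adj x * x)) * N y)\<^sup>2"
      by (simp add: power_mult_distrib op_norm_nonneg) (simp add: power2_eq_square mult_ac)
  qed (simp add: op_norm_nonneg)
  then have "op_norm x \<le> sqrt (op_norm (ga_adj x * x))"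
    by (rule op_norm_le) (simp add: op_norm_nonneg)
  then show ?thesis
    by (simp add: op_norm_nonneg sqrt_ge_absD)
qed

lemma op_norm_mult: "op_norm (x * y) \<le> op_norm x * op_norm y"
proof (rule op_norm_le)
  fix z
  have "N (x * y * z) \<le> op_norm x * N (y * z)"
    unfolding mult.assoc by (rule N_mult_le)
  also have "\<dots> \<le> op_norm x * (op_norm y * N z)"
    by (intro mult_left_mono N_mult_le op_norm_nonneg)
  finally show "N (x * y * z) \<le> op_norm x * op_norm y * N z"
    by (simp add: mult.assoc)
qed (simp add: op_norm_nonneg)

text \<open>The inequality \<open>op_norm_cstar_le\<close> for the adjoint gives
  \<open>\<parallel>x\<^sup>*\<parallel>\<^sup>2 \<le> \<parallel>x x\<^sup>*\<parallel> \<le> \<parallel>x\<parallel> \<parallel>x\<^sup>*\<parallel>\<close>, and one factor cancels.\<close>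

lemma op_norm_adj_le: "op_norm (ga_adj x) \<le> op_norm x"
proof (cases "op_norm (ga_adj x) = 0")
  case False
  have "op_norm (ga_adj x) * op_norm (ga_adj x) \<le> op_norm x * op_norm (ga_adj x)"
    using order_trans[OF op_norm_cstar_le[of "ga_adj x"] op_norm_mult]
    by (simp add: ga_adj_adj power2_eq_square)
  then show ?thesis
    using False op_norm_nonneg[of "ga_adj x"] by simp
qed (simp add: op_norm_nonneg)

lemma op_norm_scale: "op_norm (ga_scale c x) = cmod c * op_norm x"
proof -
  have le: "op_norm (ga_scale c x) \<le> cmod c * op_norm x" for c x
    by (rule op_norm_le)
       (simp_all add: ga_scale_mult_left N_scale mult.assoc mult_left_mono N_mult_le op_norm_nonneg)
  show ?thesis
  proof (cases "c = 0")
    case True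
    then show ?thesis
      using le[of 0 x] op_norm_nonneg[of 0] by auto
  next
    case False
    then have "op_norm x \<le> cmod (inverse c) * op_norm (ga_scale c x)"
      using le[of "inverse c" "ga_scale c x"] by (simp add: ga_scale_scale)
    then have "cmod c * op_norm x \<le> op_norm (ga_scale c x)"
      using False by (simp add: norm_inverse norm_divide field_simps)
    then show ?thesis
      using le[of c x] by simp
  qed
qed

lemma cstar_seminorm_op_norm: "cstar_seminorm op_norm"
  unfolding cstar_seminorm_def
proof (intro conjI allI)
  fix x y :: "'g group_algebra" and c
  show "op_norm (x + y) \<le> op_norm x + op_norm y"
  proof (rule op_norm_le)
    show "N ((x + y) * z) \<le> (op_norm x + op_norm y) * N z" for z
      using N_add[of "x * z" "y * z"] N_mult_le[of x z] N_mult_le[of y z]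
      by (simp add: distrib_right)
  qed (simp add: op_norm_nonneg)
  have "op_norm (ga_adj x * x) \<le> op_norm x * op_norm x"
    by (meson op_norm_mult op_norm_adj_le mult_right_mono op_norm_nonneg order_trans)
  then show "op_norm (ga_adj x * x) = (op_norm x)\<^sup>2"
    using op_norm_cstar_le[of x] by (simp add: power2_eq_square)
qed (fact op_norm_scale op_norm_mult)+

lemma N_1 [simp]: "N 1 = 1"
proof -
  have "ga_eval f 1 = 1"
    using ga_eval_single[of f 0 1] normalized by simp
  moreover have "ga_adj 1 = (1 :: 'g group_algebra)"
    using ga_adj_single[of 0 1] by simp
  ultimately show ?thesis
    by (simp add: N_def)
qed

text \<open>The GNS operator norm is one of the C*-seminorms over which \<^const>\<open>max_norm\<close> is the supremum,
  and \<open>ga_eval f x\<close> is a matrix coefficient of the GNS representation at the unit vector \<open>1\<close>. This is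
  the continuity that lets the functional pass to the completion.\<close>

lemma ga_eval_le_max_norm: "cmod (ga_eval f x) \<le> max_norm x"
proof -
  have "ga_adj 1 = (1 :: 'g group_algebra)"
    using ga_adj_single[of 0 1] by simp
  then have "cmod (ga_eval f x) \<le> N x"
    using Cauchy_Schwarz[of 1 x] by simp
  also have "\<dots> \<le> op_norm x"
    using N_mult_le[of x 1] by simp
  also have "\<dots> \<le> max_norm x"
    by (rule cstar_seminorm_le_max_norm[OF cstar_seminorm_op_norm])
  finally show ?thesis .
qed

end


section \<open>Extension to the completion\<close>

lemma of_group_algebra_add: "of_group_algebra (x + y) = of_group_algebra x + of_group_algebra y"
  by (simp add: of_group_algebra_def plus_group_cstar.abs_eq cauchy_rel_refl)

lemma of_group_algebra_mult: "of_group_algebra (x * y) = of_group_algebra x * of_group_algebra y"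
  by (simp add: of_group_algebra_def times_group_cstar.abs_eq cauchy_rel_refl)

lemma of_group_algebra_0: "of_group_algebra 0 = 0"
  by (simp add: of_group_algebra_def zero_group_cstar.abs_eq)

lemma of_group_algebra_scale: "of_group_algebra (ga_scale c x) = c *\<^sub>C of_group_algebra x"
  by (simp add: of_group_algebra_def scaleC_group_cstar.abs_eq cauchy_rel_refl)

lemma of_group_algebra_canonical: "of_group_algebra (Poly_Mapping.single w 1) = canonical_unitary w"
  by (simp add: of_group_algebra_def canonical_unitary.abs_eq)

lemma of_group_algebra_single:
  "of_group_algebra (Poly_Mapping.single w c) = c *\<^sub>C canonical_unitary w"
  by (simp flip: of_group_algebra_canonical of_group_algebra_scale)

lemma ga_cauchy_rep: "ga_cauchy (rep_group_cstar a)"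
  using Quotient_rep_reflp[OF Quotient_group_cstar] by (simp add: cauchy_rel_def)

lemma abs_rep_group_cstar: "abs_group_cstar (rep_group_cstar a) = a"
  by (rule Quotient_abs_rep[OF Quotient_group_cstar])

lemma rep_group_cstar_LIMSEQ: "(\<lambda>n. of_group_algebra (rep_group_cstar a n)) \<longlonglongrightarrow> a"
  using abs_group_cstar_LIMSEQ[OF ga_cauchy_rep, of a] by (simp add: abs_rep_group_cstar)

lemma adj_mult_rep_LIMSEQ:
  "(\<lambda>n. of_group_algebra (ga_adj (rep_group_cstar a n) * rep_group_cstar a n)) \<longlonglongrightarrow> adj a * a"
proof -
  have "adj a = abs_group_cstar (\<lambda>n. ga_adj (rep_group_cstar a n))"
    by (metis abs_rep_group_cstar adj_group_cstar.abs_eq cauchy_rel_refl ga_cauchy_rep)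
  then have "(\<lambda>n. of_group_algebra (ga_adj (rep_group_cstar a n))) \<longlonglongrightarrow> adj a"
    by (simp add: abs_group_cstar_LIMSEQ ga_cauchy_rep)
  then show ?thesis
    unfolding of_group_algebra_mult by (intro tendsto_mult rep_group_cstar_LIMSEQ)
qed

lemma states_iff: "\<phi> \<in> states \<longleftrightarrow> (\<forall>c a. blinfun_apply \<phi> (c *\<^sub>C a) = c * blinfun_apply \<phi> a) \<and>
    (\<forall>a. blinfun_apply \<phi> (adj a * a) \<in> \<real>\<^sub>\<ge>\<^sub>0) \<and> blinfun_apply \<phi> 1 = 1"
  by (simp add: states_def)

lemma state_of_group_algebra:
  assumes "\<phi> \<in> states"
  shows "blinfun_apply \<phi> (of_group_algebra x) = ga_eval (\<lambda>w. blinfun_apply \<phi> (canonical_unitary w)) x"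
  using assms
  by (induction x rule: ga_induct)
     (auto simp: of_group_algebra_0 of_group_algebra_add of_group_algebra_single ga_eval_add
       blinfun.add_right blinfun.zero_right states_iff)

lemma state_eqI:
  assumes "\<phi> \<in> states" "\<psi> \<in> states"
    and "\<And>w. blinfun_apply \<phi> (canonical_unitary w) = blinfun_apply \<psi> (canonical_unitary w)"
  shows "\<phi> = \<psi>"
proof (rule blinfun_eqI)
  fix a
  have "(\<lambda>n. blinfun_apply \<psi> (of_group_algebra (rep_group_cstar a n))) \<longlonglongrightarrow> blinfun_apply \<phi> a"
    using blinfun.tendsto[OF tendsto_const rep_group_cstar_LIMSEQ, of \<phi> a]
    by (simp add: state_of_group_algebra assms)
  moreover have "(\<lambda>n. blinfun_apply \<psi> (of_group_algebra (rep_group_cstar a n))) \<longlonglongrightarrow> blinfun_apply \<psi> a"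
    by (intro blinfun.tendsto tendsto_const rep_group_cstar_LIMSEQ)
  ultimately show "blinfun_apply \<phi> a = blinfun_apply \<psi> a"
    by (rule LIMSEQ_unique)
qed

context positive_definite
begin

definition extension :: "'g group_cstar \<Rightarrow> complex" where
  "extension a = lim (\<lambda>n. ga_eval f (rep_group_cstar a n))"

lemma extension_LIMSEQ:
  assumes "(\<lambda>n. of_group_algebra (X n)) \<longlonglongrightarrow> a"
  shows "(\<lambda>n. ga_eval f (X n)) \<longlonglongrightarrow> extension a"
proof -
  define Y where "Y = rep_group_cstar a"
  have "Cauchy (\<lambda>n. ga_eval f (Y n))"
    using ga_cauchy_rep[of a] unfolding Cauchy_def ga_cauchy_def dist_norm Y_def[symmetric]
      ga_eval_diff[symmetric] by (meson ga_eval_le_max_norm le_less_trans)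
  then have Y: "(\<lambda>n. ga_eval f (Y n)) \<longlonglongrightarrow> extension a"
    unfolding extension_def Y_def by (simp add: Cauchy_convergent_iff convergent_LIMSEQ_iff)
  have "(\<lambda>n. of_group_algebra (X n) - of_group_algebra (Y n)) \<longlonglongrightarrow> a - a"
    unfolding Y_def by (intro tendsto_diff assms rep_group_cstar_LIMSEQ)
  then have "(\<lambda>n. max_norm (X n - Y n)) \<longlonglongrightarrow> 0"
    using tendsto_norm by (fastforce simp flip: of_group_algebra_diff simp: norm_of_group_algebra)
  then have "(\<lambda>n. ga_eval f (X n) - ga_eval f (Y n)) \<longlonglongrightarrow> 0"
    by (rule Lim_null_comparison[rotated])
       (simp add: ga_eval_le_max_norm flip: ga_eval_diff)
  from tendsto_add[OF this Y] show ?thesis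
    by simp
qed

lemma extension_of_group_algebra: "extension (of_group_algebra x) = ga_eval f x"
  using extension_LIMSEQ[of "\<lambda>n. x"] by (simp add: LIMSEQ_const_iff)

lemma extension_add: "extension (a + b) = extension a + extension b"
proof (rule LIMSEQ_unique)
  have "(\<lambda>n. of_group_algebra (rep_group_cstar a n + rep_group_cstar b n)) \<longlonglongrightarrow> a + b"
    unfolding of_group_algebra_add by (intro tendsto_add rep_group_cstar_LIMSEQ)
  then show "(\<lambda>n. ga_eval f (rep_group_cstar a n + rep_group_cstar b n)) \<longlonglongrightarrow> extension (a + b)"
    by (rule extension_LIMSEQ)
  show "(\<lambda>n. ga_eval f (rep_group_cstar a n + rep_group_cstar b n)) \<longlonglongrightarrow> extension a + extension b"
    unfolding ga_eval_add by (intro tendsto_add extension_LIMSEQ rep_group_cstar_LIMSEQ)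
qed

lemma extension_scaleC: "extension (c *\<^sub>C a) = c * extension a"
proof (rule LIMSEQ_unique)
  have "(\<lambda>n. of_group_algebra (ga_scale c (rep_group_cstar a n))) \<longlonglongrightarrow> c *\<^sub>C a"
    using abs_group_cstar_LIMSEQ[OF ga_cauchy_scale[OF ga_cauchy_rep], of c a]
    by (metis abs_rep_group_cstar cauchy_rel_refl ga_cauchy_rep scaleC_group_cstar.abs_eq)
  then show "(\<lambda>n. ga_eval f (ga_scale c (rep_group_cstar a n))) \<longlonglongrightarrow> extension (c *\<^sub>C a)"
    by (rule extension_LIMSEQ)
  show "(\<lambda>n. ga_eval f (ga_scale c (rep_group_cstar a n))) \<longlonglongrightarrow> c * extension a"
    unfolding ga_eval_scale by (intro tendsto_mult tendsto_const extension_LIMSEQ rep_group_cstar_LIMSEQ)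
qed

lemma norm_extension_le: "norm (extension a) \<le> norm a"
proof (rule LIMSEQ_le)
  show "(\<lambda>n. norm (ga_eval f (rep_group_cstar a n))) \<longlonglongrightarrow> norm (extension a)"
    by (intro tendsto_norm extension_LIMSEQ rep_group_cstar_LIMSEQ)
  show "(\<lambda>n. norm (of_group_algebra (rep_group_cstar a n))) \<longlonglongrightarrow> norm a"
    by (intro tendsto_norm rep_group_cstar_LIMSEQ)
qed (auto simp: norm_of_group_algebra ga_eval_le_max_norm)

lemma bounded_linear_extension: "bounded_linear extension"
proof (rule bounded_linear_intro)
  show "extension (r *\<^sub>R a) = r *\<^sub>R extension a" for r a
    unfolding scaleC_of_real[symmetric] extension_scaleC by (simp add: scaleR_conv_of_real)
  show "norm (extension a) \<le> norm a * 1" for a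
    by (simp add: norm_extension_le)
qed (rule extension_add)

lemma extension_nonneg: "extension (adj a * a) \<in> \<real>\<^sub>\<ge>\<^sub>0"
  by (rule closed_sequentially[OF closed_nonneg_Reals_complex _ extension_LIMSEQ[OF adj_mult_rep_LIMSEQ]])
     (rule ga_eval_nonneg)

lemma extension_canonical_unitary: "extension (canonical_unitary w) = f w"
  by (simp add: extension_of_group_algebra flip: of_group_algebra_canonical)

lemma Blinfun_extension_state:
  "Blinfun extension \<in> states" "blinfun_apply (Blinfun extension) (canonical_unitary w) = f w"
  using extension_canonical_unitary[of 0]
  by (simp_all add: states_iff bounded_linear_Blinfun_apply bounded_linear_extension
      extension_scaleC extension_nonneg extension_canonical_unitary canonical_unitary_zero normalized)

end


section \<open>The Haagerup state\<close>

text \<open>Word length is the distance from the root of the Cayley tree, so \<open>exp (- l \<bar>u\<^sup>-\<^sup>1 v\<bar>)\<close> is \<open>r\<close> to the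
  size of a symmetric difference of edge sets, with \<open>r = exp (- l) < 1\<close>. By the expansion of that kernel
  the quadratic form is a combination of squares with nonnegative coefficients \<open>a S\<close>.\<close>

lemma positive_definite_Haagerup:
  assumes "0 < l"
  shows "positive_definite (\<lambda>w :: 'i free_group. complex_of_real (exp (- l * real (word_length w))))"
proof
  define r where "r = exp (- l)"
  have r: "0 < r" "r < 1"
    using assms by (simp_all add: r_def)
  fix x :: "'i free_group group_algebra"
  define \<Omega> where "\<Omega> = (\<Union>u\<in>Poly_Mapping.keys x. edges u)"
  define a where "a S = ((1 - r) / 2) ^ card S * ((1 + r) / 2) ^ card (\<Omega> - S)" for S
  define s where "s S u = (-1 :: real) ^ card (S \<inter> edges u)" for S :: "(('i \<times> int) list \<times> 'i \<times> int) set" and u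
  define X where "X S = (\<Sum>u\<in>Poly_Mapping.keys x. Poly_Mapping.lookup x u * of_real (s S u))" for S
  have fin: "finite \<Omega>"
    by (simp add: \<Omega>_def)
  have f: "complex_of_real (exp (- l * real (word_length (- u + v))))
      = (\<Sum>S\<in>Pow \<Omega>. of_real (a S) * (of_real (s S u) * of_real (s S v)))"
    if "u \<in> Poly_Mapping.keys x" "v \<in> Poly_Mapping.keys x" for u v
  proof -
    have "exp (- l * real (word_length (- u + v))) = r ^ card (sym_diff (edges u) (edges v))"
      unfolding r_def word_length_diff by (simp add: mult.commute flip: exp_of_nat_mult)
    also have "\<dots> = (\<Sum>S\<in>Pow \<Omega>. a S * (s S u * s S v))"
      unfolding a_def s_def by (rule pow_card_symdiff[OF fin]) (use that in \<open>auto simp: \<Omega>_def\<close>)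
    finally show ?thesis
      by simp
  qed
  have "ga_eval (\<lambda>w. complex_of_real (exp (- l * real (word_length w)))) (ga_adj x * x)
      = (\<Sum>u\<in>Poly_Mapping.keys x. \<Sum>v\<in>Poly_Mapping.keys x. \<Sum>S\<in>Pow \<Omega>. of_real (a S) *
          (cnj (Poly_Mapping.lookup x u * of_real (s S u)) * (Poly_Mapping.lookup x v * of_real (s S v))))"
    unfolding ga_eval_adj_mult
    by (intro sum.cong refl) (simp only: f sum_distrib_left complex_cnj_mult complex_cnj_complex_of_real mult_ac)
  also have "\<dots> = (\<Sum>u\<in>Poly_Mapping.keys x. \<Sum>S\<in>Pow \<Omega>. \<Sum>v\<in>Poly_Mapping.keys x. of_real (a S) *
          (cnj (Poly_Mapping.lookup x u * of_real (s S u)) * (Poly_Mapping.lookup x v * of_real (s S v))))"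
    by (intro sum.cong refl sum.swap)
  also have "\<dots> = (\<Sum>S\<in>Pow \<Omega>. \<Sum>u\<in>Poly_Mapping.keys x. \<Sum>v\<in>Poly_Mapping.keys x. of_real (a S) *
          (cnj (Poly_Mapping.lookup x u * of_real (s S u)) * (Poly_Mapping.lookup x v * of_real (s S v))))"
    by (rule sum.swap)
  also have "\<dots> = (\<Sum>S\<in>Pow \<Omega>. of_real (a S) * (cnj (X S) * X S))"
    by (simp only: X_def cnj_sum sum_product) (simp only: sum_distrib_left)
  also have "\<dots> = of_real (\<Sum>S\<in>Pow \<Omega>. a S * (cmod (X S))\<^sup>2)"
    by (simp add: complex_norm_square mult.commute[of "cnj _"] del: of_real_power)
  also have "\<dots> \<in> \<real>\<^sub>\<ge>\<^sub>0"
    unfolding nonneg_Reals_of_real_iff using r by (intro sum_nonneg) (simp add: a_def)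
  finally show "ga_eval (\<lambda>w. complex_of_real (exp (- l * real (word_length w)))) (ga_adj x * x) \<in> \<real>\<^sub>\<ge>\<^sub>0" .
qed (simp add: word_length.rep_eq zero_free_group.rep_eq)

text \<open>Existence and uniqueness of the state to which the definite description refers.\<close>

lemma haagerup_state:
  assumes "0 < l"
  shows "haagerup_state l \<in> states"
    and "blinfun_apply (haagerup_state l) (canonical_unitary w) = of_real (exp (- l * real (word_length w)))"
proof -
  interpret positive_definite "\<lambda>w :: int free_group. complex_of_real (exp (- l * real (word_length w)))"
    by (rule positive_definite_Haagerup[OF assms])
  let ?P = "\<lambda>\<phi>. \<phi> \<in> states \<and>
     (\<forall>w. blinfun_apply \<phi> (canonical_unitary w) = complex_of_real (exp (- l * real (word_length (w :: int free_group)))))"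
  have "\<exists>!\<phi>. ?P \<phi>"
  proof (rule ex1I)
    show "?P (Blinfun extension)"
      using Blinfun_extension_state by blast
    then show "\<phi> = Blinfun extension" if "?P \<phi>" for \<phi>
      by (intro state_eqI) (use that in simp_all)
  qed
  from theI'[OF this] show "haagerup_state l \<in> states"
    "blinfun_apply (haagerup_state l) (canonical_unitary w) = of_real (exp (- l * real (word_length w)))"
    unfolding haagerup_state_def by blast+
qed


section \<open>Averages over finite permutation groups\<close>

definition perms_on :: "'i set \<Rightarrow> 'i perm set" where
  "perms_on I = {\<sigma>. affected \<sigma> \<subseteq> I}"

lemma finite_perms_on:
  assumes "finite I"
  shows "finite (perms_on I)"
proof (rule finite_imageD)
  have "Perm.apply \<sigma> permutes I" if "\<sigma> \<in> perms_on I" for \<sigma>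
    using that bij_apply[of \<sigma>]
    by (auto simp: perms_on_def permutes_def in_affected bij_iff)
  then have "Perm.apply ` perms_on I \<subseteq> {p. p permutes I}"
    by blast
  then show "finite (Perm.apply ` perms_on I)"
    using finite_permutations[OF assms] finite_subset by blast
  show "inj_on Perm.apply (perms_on I)"
    by (auto simp: inj_on_def perm_eq_iff)
qed

lemma one_perms_on [simp]: "1 \<in> perms_on I"
  by (simp add: perms_on_def)

lemma times_perms_on: "\<sigma> \<in> perms_on I \<Longrightarrow> \<tau> \<in> perms_on I \<Longrightarrow> \<sigma> * \<tau> \<in> perms_on I"
  using affected_times[of \<sigma> \<tau>] unfolding perms_on_def by blast

lemma inverse_perms_on [simp]: "inverse \<sigma> \<in> perms_on I \<longleftrightarrow> \<sigma> \<in> perms_on I"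
  by (simp add: perms_on_def)

lemma card_perms_on: "finite I \<Longrightarrow> 0 < card (perms_on I)"
  using one_perms_on[of I] by (metis card_gt_0_iff empty_iff finite_perms_on)

text \<open>Composition with transpositions shows that the image of \<open>s\<close> is uniformly distributed over \<open>I\<close>.\<close>

lemma card_perms_on_eq:
  assumes "finite I" "s \<in> I" "t \<in> I"
  shows "card I * card {\<sigma> \<in> perms_on I. Perm.apply \<sigma> s = t} \<le> card (perms_on I)"
proof -
  let ?P = "\<lambda>t. {\<sigma> \<in> perms_on I. Perm.apply \<sigma> s = t}"
  have fin: "finite (?P t)" for t
    using finite_perms_on[OF assms(1)] by simp
  have "card (?P t) \<le> card (?P t')" if "t' \<in> I" for t'
  proof (rule card_inj_on_le[OF _ _ fin])
    show "inj_on ((*) (swap t t')) (?P t)"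
      by (rule inj_on_inverseI[of _ "(*) (swap t t')"]) (simp flip: mult.assoc)
    have "swap t t' \<in> perms_on I"
      using assms(3) that affected_swap[of t t'] by (cases "t = t'") (auto simp: perms_on_def)
    then show "(*) (swap t t') ` ?P t \<subseteq> ?P t'"
      by (auto simp: times_perms_on apply_times)
  qed
  then have "card I * card (?P t) \<le> (\<Sum>t'\<in>I. card (?P t'))"
    using sum_bounded_below[of I "card (?P t)" "\<lambda>t'. card (?P t')"] by simp
  also have "\<dots> = card (\<Union>t'\<in>I. ?P t')"
    by (rule card_UN_disjoint[symmetric]) (use assms fin in auto)
  also have "\<dots> \<le> card (perms_on I)"
    by (rule card_mono) (use finite_perms_on[OF assms(1)] in auto)
  finally show ?thesis .
qed

definition perm_average :: "'i set \<Rightarrow> ('i perm \<Rightarrow> complex) \<Rightarrow> complex" where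
  "perm_average I g = (\<Sum>\<sigma>\<in>perms_on I. g \<sigma>) / of_nat (card (perms_on I))"

lemma perm_average_add: "perm_average I (\<lambda>\<sigma>. g \<sigma> + h \<sigma>) = perm_average I g + perm_average I h"
  by (simp add: perm_average_def sum.distrib add_divide_distrib)

lemma perm_average_diff: "perm_average I (\<lambda>\<sigma>. g \<sigma> - h \<sigma>) = perm_average I g - perm_average I h"
  by (simp add: perm_average_def sum_subtractf diff_divide_distrib)

lemma perm_average_mult: "perm_average I (\<lambda>\<sigma>. c * g \<sigma>) = c * perm_average I g"
  by (simp add: perm_average_def flip: sum_distrib_left)

lemma perm_average_const: "finite I \<Longrightarrow> perm_average I (\<lambda>\<sigma>. c) = c"
  using card_perms_on[of I] by (simp add: perm_average_def)

lemma norm_perm_average_le: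
  assumes "\<And>\<sigma>. norm (g \<sigma>) \<le> K"
  shows "norm (perm_average I g) \<le> K"
proof (cases "card (perms_on I) = 0")
  case True
  then show ?thesis
    using order_trans[OF norm_ge_zero assms] by (simp add: perm_average_def)
next
  case False
  have "norm (\<Sum>\<sigma>\<in>perms_on I. g \<sigma>) \<le> real (card (perms_on I)) * K"
    by (rule sum_norm_bound) (rule assms)
  then show ?thesis
    using False by (simp add: perm_average_def norm_divide field_simps)
qed

lemma filterlim_card_finite_subsets:
  assumes "infinite (UNIV :: 'i set)"
  shows "filterlim (\<lambda>I :: 'i set. real (card I)) at_top (finite_subsets_at_top UNIV)"
proof -
  have "filterlim (\<lambda>I :: 'i set. card I) at_top (finite_subsets_at_top UNIV)"
    unfolding filterlim_at_top eventually_finite_subsets_at_top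
  proof
    fix n
    obtain X :: "'i set" where "finite X" "card X = n"
      using infinite_arbitrarily_large[OF assms] by blast
    then show "\<exists>X :: 'i set. finite X \<and> X \<subseteq> UNIV \<and> (\<forall>Y. finite Y \<and> X \<subseteq> Y \<and> Y \<subseteq> UNIV \<longrightarrow> n \<le> card Y)"
      using card_mono by blast
  qed
  then show ?thesis
    by (rule filterlim_compose[OF filterlim_real_sequentially])
qed

text \<open>The permutations on \<open>I\<close> that move some element of \<open>S\<close> into \<open>T\<close> have density at most
  \<open>card S * card T / card I\<close>, hence a negligible share in the limit.\<close>

lemma perm_average_tendsto:
  fixes g :: "'i perm \<Rightarrow> complex"
  assumes inf: "infinite (UNIV :: 'i set)" and fin: "finite S" "finite T"
    and bound: "\<And>\<sigma>. norm (g \<sigma> - c) \<le> K"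
    and eq: "\<And>\<sigma>. Perm.apply \<sigma> ` S \<inter> T = {} \<Longrightarrow> g \<sigma> = c"
  shows "((\<lambda>I. perm_average I g) \<longlongrightarrow> c) (finite_subsets_at_top UNIV)"
proof (rule LIM_zero_cancel, rule Lim_null_comparison)
  let ?M = "real (card S * card T) * K"
  show "((\<lambda>I :: 'i set. ?M / real (card I)) \<longlongrightarrow> 0) (finite_subsets_at_top UNIV)"
    by (rule real_tendsto_divide_at_top[OF tendsto_const filterlim_card_finite_subsets[OF inf]])
  have K: "0 \<le> K"
    using order_trans[OF norm_ge_zero bound] .
  have "norm (perm_average I g - c) \<le> ?M / real (card I)"
    if I: "finite I" "S \<union> T \<subseteq> I" for I
  proof (cases "I = {}")
    case True
    then show ?thesis
      using I eq perm_average_const[of I c] by (simp add: fin) (simp add: perm_average_def)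
  next
    case False
    let ?P = "\<lambda>s t. {\<sigma> \<in> perms_on I. Perm.apply \<sigma> s = t}"
    define bad where "bad = (\<Union>s\<in>S. \<Union>t\<in>T. ?P s t)"
    have pos: "0 < card I" "0 < card (perms_on I)"
      using False I card_perms_on by (auto simp: card_gt_0_iff)
    have finP: "finite (perms_on I)"
      by (rule finite_perms_on[OF I(1)])
    have "card bad \<le> (\<Sum>s\<in>S. \<Sum>t\<in>T. card (?P s t))"
      unfolding bad_def
      by (rule order_trans[OF card_UN_le[OF fin(1)]]) (intro sum_mono card_UN_le fin)
    then have "card I * card bad \<le> (\<Sum>s\<in>S. \<Sum>t\<in>T. card I * card (?P s t))"
      by (simp flip: sum_distrib_left)
    also have "\<dots> \<le> (\<Sum>s\<in>S. \<Sum>t\<in>T. card (perms_on I))"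
      by (intro sum_mono card_perms_on_eq) (use I in auto)
    finally have bad: "card I * card bad \<le> card S * card T * card (perms_on I)"
      by simp
    have "norm (\<Sum>\<sigma>\<in>perms_on I. g \<sigma> - c) = norm (\<Sum>\<sigma>\<in>bad. g \<sigma> - c)"
      by (intro arg_cong[where f = norm] sum.mono_neutral_right finP)
         (use eq in \<open>auto simp: bad_def\<close>)
    also have "\<dots> \<le> real (card bad) * K"
      by (rule sum_norm_bound) (rule bound)
    finally have "real (card I) * norm (\<Sum>\<sigma>\<in>perms_on I. g \<sigma> - c) \<le> real (card I * card bad) * K"
      by (simp add: mult_left_mono mult.assoc)
    also have "\<dots> \<le> real (card S * card T * card (perms_on I)) * K"
      using bad K by (intro mult_right_mono) (simp_all only: of_nat_le_iff)
    finally have *: "real (card I) * norm (\<Sum>\<sigma>\<in>perms_on I. g \<sigma> - c) \<le> ?M * real (card (perms_on I))"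
      by (simp add: mult_ac)
    have "perm_average I g - c = perm_average I (\<lambda>\<sigma>. g \<sigma> - c)"
      by (simp add: perm_average_diff perm_average_const I)
    also have "norm \<dots> = norm (\<Sum>\<sigma>\<in>perms_on I. g \<sigma> - c) / real (card (perms_on I))"
      by (simp add: perm_average_def norm_divide)
    also have "\<dots> \<le> ?M / real (card I)"
      using * pos by (simp add: divide_le_eq le_divide_eq mult.commute)
    finally show ?thesis .
  qed
  then show "eventually (\<lambda>I. norm (perm_average I g - c) \<le> ?M / real (card I)) (finite_subsets_at_top UNIV)"
    unfolding eventually_finite_subsets_at_top by (intro exI[of _ "S \<union> T"]) (use fin in auto)
qed


section \<open>The permutation action\<close>

lemma perm_aut_of_group_algebra:
  "perm_aut \<sigma> (of_group_algebra x) = of_group_algebra (ga_map (permute_word \<sigma>) x)"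
  by (simp add: of_group_algebra_def perm_aut.abs_eq cauchy_rel_refl)

lemma perm_aut_canonical_unitary:
  "perm_aut \<sigma> (canonical_unitary w) = canonical_unitary (permute_word \<sigma> w)"
  by (simp add: perm_aut_of_group_algebra flip: of_group_algebra_canonical)

lemma norm_perm_aut_le: "norm (perm_aut \<sigma> a) \<le> norm a"
proof transfer
  fix \<sigma> :: "'a perm" and X :: "nat \<Rightarrow> 'a free_group group_algebra"
  assume X: "cauchy_rel X X"
  show "lim (\<lambda>n. max_norm (ga_map (permute_word \<sigma>) (X n))) \<le> lim (\<lambda>n. max_norm (X n))"
    by (rule LIMSEQ_le[OF ga_cauchy_norm_LIMSEQ ga_cauchy_norm_LIMSEQ])
       (use X in \<open>auto simp: cauchy_rel_def max_norm_ga_map_le permute_word_add\<close>)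
qed

lemma bounded_linear_perm_aut: "bounded_linear (perm_aut \<sigma>)"
proof (rule bounded_linear_intro)
  show "perm_aut \<sigma> (r *\<^sub>R a) = r *\<^sub>R perm_aut \<sigma> a" for r a
    unfolding scaleC_of_real[symmetric] by (rule perm_aut_scaleC)
  show "norm (perm_aut \<sigma> a) \<le> norm a * 1" for a
    by (simp add: norm_perm_aut_le)
qed (rule perm_aut_add)

lemma perm_aut_diff: "perm_aut \<sigma> (a - b) = perm_aut \<sigma> a - perm_aut \<sigma> b"
  by (rule linear_diff[OF bounded_linear.linear[OF bounded_linear_perm_aut]])

lemma perm_aut_0: "perm_aut \<sigma> 0 = 0"
  using perm_aut_diff[of \<sigma> 0 0] by simp

lemma permute_word_times: "permute_word (\<sigma> * \<tau>) w = permute_word \<sigma> (permute_word \<tau> w)"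
  by (simp only: syllables_inject[symmetric] permute_word.rep_eq) (simp add: apply_times case_prod_unfold)

lemma ga_map_ga_map: "ga_map g (ga_map h x) = ga_map (\<lambda>w. g (h w)) x"
  by (induction x rule: ga_induct) (auto simp: ga_map_add)

lemma ga_map_permute_times:
  "ga_map (permute_word (\<sigma> * \<tau>)) x = ga_map (permute_word \<sigma>) (ga_map (permute_word \<tau>) x)"
  by (simp add: ga_map_ga_map permute_word_times[abs_def])

lemma perm_aut_times: "perm_aut (\<sigma> * \<tau>) a = perm_aut \<sigma> (perm_aut \<tau> a)"
  by transfer (simp add: cauchy_rel_def ga_map_permute_times)

lemma word_length_permute: "word_length (permute_word \<sigma> w) = word_length w"
  by (simp add: word_length.rep_eq permute_word.rep_eq comp_def case_prod_unfold)

lemma symmetric_stateI: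
  assumes "\<phi> \<in> states"
    and "\<And>\<sigma> w. blinfun_apply \<phi> (canonical_unitary (permute_word \<sigma> w)) = blinfun_apply \<phi> (canonical_unitary w)"
  shows "\<phi> \<in> symmetric_states"
proof -
  have eq: "blinfun_apply \<phi> (perm_aut \<sigma> (of_group_algebra x)) = blinfun_apply \<phi> (of_group_algebra x)" for \<sigma> x
    using assms(1)
    by (induction x rule: ga_induct)
       (auto simp: of_group_algebra_0 of_group_algebra_add of_group_algebra_single perm_aut_0
         perm_aut_add perm_aut_scaleC perm_aut_canonical_unitary assms(2)
         blinfun.add_right blinfun.zero_right states_iff)
  have "blinfun_apply \<phi> (perm_aut \<sigma> a) = blinfun_apply \<phi> a" for \<sigma> a
  proof (rule LIMSEQ_unique)
    let ?X = "\<lambda>n. of_group_algebra (rep_group_cstar a n)"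
    show "(\<lambda>n. blinfun_apply \<phi> (?X n)) \<longlonglongrightarrow> blinfun_apply \<phi> a"
      by (intro blinfun.tendsto tendsto_const rep_group_cstar_LIMSEQ)
    have "(\<lambda>n. blinfun_apply \<phi> (perm_aut \<sigma> (?X n))) \<longlonglongrightarrow> blinfun_apply \<phi> (perm_aut \<sigma> a)"
      by (intro blinfun.tendsto tendsto_const bounded_linear.tendsto[OF bounded_linear_perm_aut]
          rep_group_cstar_LIMSEQ)
    then show "(\<lambda>n. blinfun_apply \<phi> (?X n)) \<longlonglongrightarrow> blinfun_apply \<phi> (perm_aut \<sigma> a)"
      by (simp add: eq)
  qed
  then show ?thesis
    using assms(1) by (simp add: symmetric_states_def)
qed


section \<open>Weak clustering of the Haagerup state\<close>

definition support :: "'i free_group \<Rightarrow> 'i set" where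
  "support w = fst ` set (syllables w)"

lemma finite_support: "finite (support w)"
  by (simp add: support_def)

text \<open>Syllables merge or cancel across the join only if they share a generator.\<close>

lemma word_length_add_disjoint:
  assumes "support u \<inter> support v = {}"
  shows "word_length (u + v) = word_length u + word_length v"
  using assms unfolding support_def
proof transfer
  fix u v :: "('a \<times> int) list"
  assume red: "reduced u" "reduced v" and "fst ` set u \<inter> fst ` set v = {}"
  then have "fst (last u) \<noteq> fst (hd v)" if "u \<noteq> []" "v \<noteq> []"
    using that by (metis disjoint_iff hd_in_set imageI last_in_set)
  then have "reduced (u @ v)"
    using red by (simp add: reduced_append)
  then show "list_length (word_mult u v) = list_length u + list_length v"
    by (simp add: word_mult_reduced_append)
qed

lemma support_permute: "support (permute_word \<sigma> w) = Perm.apply \<sigma> ` support w"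
  by (simp add: support_def permute_word.rep_eq image_image case_prod_unfold)

text \<open>Equicontinuity: a uniform bound carries convergence from the dense group algebra to its
  completion.\<close>

lemma tendsto_dense:
  fixes T :: "'j \<Rightarrow> 'g::group_add group_cstar \<Rightarrow> complex"
  assumes diff: "\<And>i a b. T i (a - b) = T i a - T i b" "\<And>a b. L (a - b) = L a - L b"
    and bound: "\<And>i a. norm (T i a) \<le> K * norm a" "\<And>a. norm (L a) \<le> K * norm a"
    and lim: "\<And>x. ((\<lambda>i. T i (of_group_algebra x)) \<longlongrightarrow> L (of_group_algebra x)) F"
  shows "((\<lambda>i. T i a) \<longlongrightarrow> L a) F"
proof (rule tendstoI)
  fix e :: real
  assume "0 < e"
  define \<delta> where "\<delta> = e / 3 / (\<bar>K\<bar> + 1)"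
  have "0 < \<delta>"
    using \<open>0 < e\<close> by (simp add: \<delta>_def)
  then obtain x where x: "norm (a - of_group_algebra x) < \<delta>"
    using of_group_algebra_dense by blast
  have "K * norm (a - of_group_algebra x) \<le> (\<bar>K\<bar> + 1) * norm (a - of_group_algebra x)"
    by (intro mult_right_mono) auto
  also have "\<dots> < (\<bar>K\<bar> + 1) * \<delta>"
    using x by (intro mult_strict_left_mono) auto
  also have "\<dots> = e / 3"
    unfolding \<delta>_def times_divide_eq_right[of "\<bar>K\<bar> + 1" "e / 3"]
    by (rule nonzero_mult_div_cancel_left) linarith
  finally have K: "K * norm (a - of_group_algebra x) < e / 3" .
  have "eventually (\<lambda>i. dist (T i (of_group_algebra x)) (L (of_group_algebra x)) < e / 3) F"
    by (rule tendstoD[OF lim]) (use \<open>0 < e\<close> in simp)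
  then show "eventually (\<lambda>i. dist (T i a) (L a) < e) F"
  proof (rule eventually_mono)
    fix i
    let ?x = "of_group_algebra x"
    assume "dist (T i ?x) (L ?x) < e / 3"
    moreover have "T i a - L a = T i (a - ?x) + (T i ?x - L ?x) - L (a - ?x)"
      by (simp add: diff)
    then have "norm (T i a - L a) \<le> norm (T i (a - ?x)) + norm (T i ?x - L ?x) + norm (L (a - ?x))"
      using norm_triangle_ineq4[of "T i (a - ?x) + (T i ?x - L ?x)" "L (a - ?x)"]
        norm_triangle_ineq[of "T i (a - ?x)" "T i ?x - L ?x"] by simp
    ultimately show "dist (T i a) (L a) < e"
      using K bound(1)[of i "a - ?x"] bound(2)[of "a - ?x"] by (simp add: dist_norm)
  qed
qed

text \<open>Both sides of the clustering condition are bilinear and bounded by a multiple of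
  \<open>\<parallel>A\<parallel> \<parallel>B\<parallel>\<close> uniformly in \<open>I\<close>, so group elements suffice.\<close>

lemma weakly_clusteringI:
  fixes \<phi> :: "'i free_group group_cstar \<Rightarrow>\<^sub>L complex"
  assumes sym: "\<phi> \<in> symmetric_states"
    and words: "\<And>u v. ((\<lambda>I. perm_average I (\<lambda>\<sigma>. blinfun_apply \<phi> (canonical_unitary (permute_word \<sigma> u + v))))
        \<longlongrightarrow> blinfun_apply \<phi> (canonical_unitary u) * blinfun_apply \<phi> (canonical_unitary v))
        (finite_subsets_at_top UNIV)"
  shows "weakly_clustering \<phi>"
proof -
  define T where "T A B I = perm_average I (\<lambda>\<sigma>. blinfun_apply \<phi> (perm_aut \<sigma> A * B))" for A B I
  define P where "P A B \<longleftrightarrow> (T A B \<longlongrightarrow> blinfun_apply \<phi> A * blinfun_apply \<phi> B) (finite_subsets_at_top UNIV)" for A B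
  have \<phi>: "\<phi> \<in> states"
    using sym by (simp add: symmetric_states_def)
  then have scale: "blinfun_apply \<phi> (c *\<^sub>C a) = c * blinfun_apply \<phi> a" for c a
    by (simp add: states_iff)
  have T_add: "T (A + A') B I = T A B I + T A' B I" "T A (B + B') I = T A B I + T A B' I" for A A' B B' I
    by (simp_all add: T_def perm_aut_add distrib_left distrib_right blinfun.add_right perm_average_add)
  have T_diff: "T (A - A') B I = T A B I - T A' B I" "T A (B - B') I = T A B I - T A B' I" for A A' B B' I
    by (simp_all add: T_def perm_aut_diff left_diff_distrib right_diff_distrib blinfun.diff_right perm_average_diff)
  have T_scale: "T (c *\<^sub>C A) (d *\<^sub>C B) I = (c * d) * T A B I" for A B c d I
    by (simp add: T_def perm_aut_scaleC scaleC_mult_left scaleC_mult_right scaleC_scaleC scale mult.assoc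
        mult.left_commute flip: perm_average_mult)
  have T_0: "T 0 B = (\<lambda>I. 0)" "T A 0 = (\<lambda>I. 0)" for A B
    by (simp_all add: T_def perm_aut_0 blinfun.zero_right perm_average_def fun_eq_iff)
  have bound_\<phi>: "norm (blinfun_apply \<phi> A * blinfun_apply \<phi> B) \<le> (norm \<phi> * norm \<phi>) * (norm A * norm B)" for A B
    using mult_mono[OF norm_blinfun[of \<phi> A] norm_blinfun[of \<phi> B]] by (simp add: norm_mult mult_ac)
  have bound_T: "norm (T A B I) \<le> norm \<phi> * (norm A * norm B)" for A B I
    unfolding T_def
  proof (rule norm_perm_average_le)
    fix \<sigma>
    have "norm (blinfun_apply \<phi> (perm_aut \<sigma> A * B)) \<le> norm \<phi> * norm (perm_aut \<sigma> A * B)"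
      by (rule norm_blinfun)
    also have "\<dots> \<le> norm \<phi> * (norm A * norm B)"
      by (intro mult_left_mono order_trans[OF norm_mult_ineq] mult_right_mono norm_perm_aut_le) auto
    finally show "norm (blinfun_apply \<phi> (perm_aut \<sigma> A * B)) \<le> norm \<phi> * (norm A * norm B)" .
  qed
  define M where "M = norm \<phi> + norm \<phi> * norm \<phi>"
  have M: "norm \<phi> \<le> M" "norm \<phi> * norm \<phi> \<le> M"
    by (simp_all add: M_def)
  have bounds: "norm (T A B I) \<le> M * (norm A * norm B)"
    "norm (blinfun_apply \<phi> A * blinfun_apply \<phi> B) \<le> M * (norm A * norm B)" for A B I
    by (rule order_trans[OF bound_T mult_right_mono[OF M(1)]], simp)
       (rule order_trans[OF bound_\<phi> mult_right_mono[OF M(2)]], simp)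
  have P_0: "P 0 B" "P A 0" for A B
    unfolding P_def T_0 blinfun.zero_right by simp_all
  have P_add_left: "P (A + A') B" if "P A B" "P A' B" for A A' B
    using tendsto_add[OF that[unfolded P_def]]
    unfolding P_def ext[OF T_add(1)] blinfun.add_right distrib_right .
  have P_add_right: "P A (B + B')" if "P A B" "P A B'" for A B B'
    using tendsto_add[OF that[unfolded P_def]]
    unfolding P_def ext[OF T_add(2)] blinfun.add_right distrib_left .
  have words': "P (of_group_algebra (Poly_Mapping.single u c)) (of_group_algebra (Poly_Mapping.single v d))" for u v c d
  proof -
    have "T (canonical_unitary u) (canonical_unitary v)
        = (\<lambda>I. perm_average I (\<lambda>\<sigma>. blinfun_apply \<phi> (canonical_unitary (permute_word \<sigma> u + v))))"
      by (simp add: T_def perm_aut_canonical_unitary canonical_unitary_add fun_eq_iff)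
    then have "((\<lambda>I. (c * d) * T (canonical_unitary u) (canonical_unitary v) I) \<longlongrightarrow>
        (c * d) * (blinfun_apply \<phi> (canonical_unitary u) * blinfun_apply \<phi> (canonical_unitary v)))
        (finite_subsets_at_top UNIV)"
      by (simp only: tendsto_mult_left words)
    moreover have "(c * d) * (blinfun_apply \<phi> (canonical_unitary u) * blinfun_apply \<phi> (canonical_unitary v))
        = c * blinfun_apply \<phi> (canonical_unitary u) * (d * blinfun_apply \<phi> (canonical_unitary v))"
      by (simp only: mult_ac)
    ultimately show ?thesis
      unfolding P_def of_group_algebra_single scale ext[OF T_scale] by (simp only:)
  qed
  have "P (of_group_algebra x) (of_group_algebra (Poly_Mapping.single v d))" for x v d
    by (induction x rule: ga_induct)
       (simp_all only: of_group_algebra_0 of_group_algebra_add P_0 P_add_left words')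
  then have P_dense: "P (of_group_algebra x) (of_group_algebra y)" for x y
    by (induction y rule: ga_induct)
       (simp_all only: of_group_algebra_0 of_group_algebra_add P_0 P_add_right)
  have P_left: "P A (of_group_algebra y)" for A y
    unfolding P_def
  proof (rule tendsto_dense[where K = "M * norm (of_group_algebra y)" and T = "\<lambda>I A. T A (of_group_algebra y) I"])
    show "norm (T A (of_group_algebra y) I) \<le> M * norm (of_group_algebra y) * norm A"
      "norm (blinfun_apply \<phi> A * blinfun_apply \<phi> (of_group_algebra y)) \<le> M * norm (of_group_algebra y) * norm A" for A I
      using bounds[of A "of_group_algebra y"] by (simp_all only: mult_ac)
  qed (simp_all only: T_diff blinfun.diff_right left_diff_distrib P_dense[unfolded P_def])
  have "P A B" for A B
    unfolding P_def
  proof (rule tendsto_dense[where K = "M * norm A" and T = "\<lambda>I B. T A B I"])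
    show "norm (T A B I) \<le> M * norm A * norm B"
      "norm (blinfun_apply \<phi> A * blinfun_apply \<phi> B) \<le> M * norm A * norm B" for B I
      using bounds[of A B] by (simp_all only: mult.assoc)
  qed (simp_all only: T_diff blinfun.diff_right right_diff_distrib P_left[unfolded P_def])
  then show ?thesis
    using sym unfolding weakly_clustering_def P_def T_def perm_average_def perms_on_def by simp
qed

text \<open>For all but a negligible share of the permutations the words \<open>\<sigma>(u)\<close> and \<open>v\<close> have no generator in
  common; then their lengths add up and the state is multiplicative on them.\<close>

lemma weakly_clustering_haagerup_state:
  assumes "0 < l"
  shows "weakly_clustering (haagerup_state l)"
proof (rule weakly_clusteringI)
  note val = haagerup_state(2)[OF assms]
  show "haagerup_state l \<in> symmetric_states"
    by (rule symmetric_stateI) (simp_all add: haagerup_state assms word_length_permute)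
  fix u v :: "int free_group"
  let ?f = "\<lambda>w. exp (- l * real (word_length (w :: int free_group)))"
  show "((\<lambda>I. perm_average I (\<lambda>\<sigma>. blinfun_apply (haagerup_state l) (canonical_unitary (permute_word \<sigma> u + v))))
      \<longlongrightarrow> blinfun_apply (haagerup_state l) (canonical_unitary u) * blinfun_apply (haagerup_state l) (canonical_unitary v))
      (finite_subsets_at_top UNIV)"
    unfolding val
  proof (rule perm_average_tendsto[OF infinite_UNIV_int finite_support finite_support])
    have f: "cmod (of_real (?f w)) \<le> 1" for w
      unfolding norm_of_real using assms by simp
    show "cmod (of_real (?f (permute_word \<sigma> u + v)) - of_real (?f u) * of_real (?f v)) \<le> 2" for \<sigma>
      using norm_triangle_ineq4[of "of_real (?f (permute_word \<sigma> u + v)) :: complex" "of_real (?f u) * of_real (?f v)"]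
        f[of "permute_word \<sigma> u + v"] mult_le_one[OF f norm_ge_zero f, of u v]
      unfolding norm_mult by linarith
    show "of_real (?f (permute_word \<sigma> u + v)) = complex_of_real (?f u) * of_real (?f v)"
      if "Perm.apply \<sigma> ` support u \<inter> support v = {}" for \<sigma>
      using that
      unfolding of_real_mult[symmetric] of_real_eq_iff mult_exp_exp
      by (simp add: word_length_add_disjoint support_permute word_length_permute distrib_left)
  qed
qed


section \<open>Weakly clustering states are extreme\<close>

lemma positive_form_state:
  assumes "\<phi> \<in> states"
  shows "positive_form scaleC (\<lambda>a b. blinfun_apply \<phi> (adj a * b))"
  using assms
  by unfold_locales
     (auto simp: states_iff adj_add adj_scaleC distrib_left distrib_right blinfun.add_right
       scaleC_mult_left scaleC_mult_right)

lemma adj_one: "adj (1 :: 'a::cstar_algebra) = 1"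
  by (metis adj_adj adj_mult mult.left_neutral mult.right_neutral)

lemma state_Cauchy_Schwarz:
  assumes "\<phi> \<in> states"
  shows "(cmod (blinfun_apply \<phi> a))\<^sup>2 \<le> Re (blinfun_apply \<phi> (adj a * a))"
proof -
  interpret positive_form scaleC "\<lambda>a b. blinfun_apply \<phi> (adj a * b)"
    by (rule positive_form_state[OF assms])
  have "cmod (blinfun_apply \<phi> a) \<le> N a"
    using Cauchy_Schwarz[of 1 a] assms by (simp add: adj_one N_def states_iff)
  then show ?thesis
    unfolding N_square[symmetric] by (rule power_mono) simp
qed

lemma adj_0 [simp]: "adj (0 :: 'a::cstar_algebra) = 0"
  using adj_add[of "0 :: 'a" 0] by simp

lemma adj_sum: "adj (sum g A) = (\<Sum>a\<in>A. adj (g a))" for g :: "'b \<Rightarrow> 'a::cstar_algebra"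
  by (induction A rule: infinite_finite_induct) (simp_all add: adj_add)

text \<open>By invariance, a term of the double sum over \<open>\<sigma>\<close> and \<open>\<tau>\<close> depends only on \<open>\<tau>\<^sup>-\<^sup>1 \<sigma>\<close>, and the
  permutations on \<open>I\<close> form a group. Thus the mean square of an average becomes a correlation of the
  kind that weak clustering controls.\<close>

lemma symmetric_state_average_square:
  assumes "\<phi> \<in> symmetric_states"
  shows "blinfun_apply \<phi> (adj (\<Sum>\<sigma>\<in>perms_on I. perm_aut \<sigma> A) * (\<Sum>\<sigma>\<in>perms_on I. perm_aut \<sigma> A))
    = of_nat (card (perms_on I)) * (\<Sum>\<sigma>\<in>perms_on I. blinfun_apply \<phi> (perm_aut \<sigma> (adj A) * A))"
proof -
  have inv: "blinfun_apply \<phi> (perm_aut \<sigma> a) = blinfun_apply \<phi> a" for \<sigma> a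
    using assms by (simp add: symmetric_states_def)
  have "blinfun_apply \<phi> (adj (\<Sum>\<sigma>\<in>perms_on I. perm_aut \<sigma> A) * (\<Sum>\<sigma>\<in>perms_on I. perm_aut \<sigma> A))
      = (\<Sum>\<tau>\<in>perms_on I. \<Sum>\<sigma>\<in>perms_on I. blinfun_apply \<phi> (perm_aut \<sigma> (adj A) * perm_aut \<tau> A))"
    unfolding adj_sum sum_product blinfun.sum_right perm_aut_adj by (rule sum.swap)
  also have "\<dots> = (\<Sum>\<tau>\<in>perms_on I. \<Sum>\<sigma>\<in>perms_on I. blinfun_apply \<phi> (perm_aut \<sigma> (adj A) * A))"
  proof (rule sum.cong[OF refl])
    fix \<tau> :: "'a perm"
    assume \<tau>: "\<tau> \<in> perms_on I"
    have "(\<Sum>\<sigma>\<in>perms_on I. blinfun_apply \<phi> (perm_aut \<sigma> (adj A) * A))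
        = (\<Sum>\<sigma>\<in>perms_on I. blinfun_apply \<phi> (perm_aut (\<tau> * \<sigma>) (adj A) * perm_aut \<tau> A))"
      unfolding perm_aut_times perm_aut_mult[symmetric] inv ..
    also have "\<dots> = (\<Sum>\<sigma>\<in>perms_on I. blinfun_apply \<phi> (perm_aut \<sigma> (adj A) * perm_aut \<tau> A))"
      by (rule sum.reindex_bij_witness[where i = "\<lambda>\<sigma>. inverse \<tau> * \<sigma>" and j = "\<lambda>\<sigma>. \<tau> * \<sigma>"])
         (use \<tau> in \<open>auto simp: times_perms_on simp flip: mult.assoc\<close>)
    finally show "(\<Sum>\<sigma>\<in>perms_on I. blinfun_apply \<phi> (perm_aut \<sigma> (adj A) * perm_aut \<tau> A))
        = (\<Sum>\<sigma>\<in>perms_on I. blinfun_apply \<phi> (perm_aut \<sigma> (adj A) * A))" ..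
  qed
  finally show ?thesis
    by simp
qed

text \<open>If \<open>\<phi> A = 0\<close>, clustering lets the averages of \<open>A\<close> tend to zero in mean square under \<open>\<phi>\<close>, hence
  under the dominated \<open>\<psi>\<close>. But \<open>\<psi>\<close> takes the value \<open>\<psi> A\<close> on each of these averages, so
  \<open>\<psi> A = 0\<close>. Functionals with nested kernels that agree at \<open>1\<close> are equal.\<close>

lemma weakly_clustering_dominates:
  assumes \<phi>: "weakly_clustering \<phi>" and \<psi>: "\<psi> \<in> symmetric_states" and "0 < t"
    and dom: "\<And>a. t * Re (blinfun_apply \<psi> (adj a * a)) \<le> Re (blinfun_apply \<phi> (adj a * a))"
  shows "\<psi> = \<phi>"
proof (rule blinfun_eqI)
  have \<phi>_sym: "\<phi> \<in> symmetric_states" and states: "\<phi> \<in> states" "\<psi> \<in> states"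
    using \<phi> \<psi> by (auto simp: weakly_clustering_def symmetric_states_def)
  have ker: "blinfun_apply \<psi> A = 0" if A: "blinfun_apply \<phi> A = 0" for A
  proof -
    let ?avg = "\<lambda>I. (\<Sum>\<sigma>\<in>perms_on I. blinfun_apply \<phi> (perm_aut \<sigma> (adj A) * A)) / of_nat (card (perms_on I))"
    have "(?avg \<longlongrightarrow> blinfun_apply \<phi> (adj A) * blinfun_apply \<phi> A) (finite_subsets_at_top UNIV)"
      using \<phi> unfolding weakly_clustering_def perms_on_def by blast
    then have lim: "((\<lambda>I. Re (?avg I)) \<longlongrightarrow> 0) (finite_subsets_at_top UNIV)"
      using tendsto_Re A by fastforce
    have "t * (cmod (blinfun_apply \<psi> A))\<^sup>2 \<le> Re (?avg I)" if "finite I" for I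
    proof -
      let ?S = "\<Sum>\<sigma>\<in>perms_on I. perm_aut \<sigma> A" and ?n = "real (card (perms_on I))"
      have n: "0 < ?n"
        using card_perms_on[OF that] by simp
      have "blinfun_apply \<psi> ?S = of_real ?n * blinfun_apply \<psi> A"
        using \<psi> by (simp add: blinfun.sum_right symmetric_states_def)
      then have "?n\<^sup>2 * (t * (cmod (blinfun_apply \<psi> A))\<^sup>2) = t * (cmod (blinfun_apply \<psi> ?S))\<^sup>2"
        by (simp add: norm_mult power_mult_distrib)
      also have "\<dots> \<le> t * Re (blinfun_apply \<psi> (adj ?S * ?S))"
        using \<open>0 < t\<close> state_Cauchy_Schwarz[OF states(2)] by simp
      also have "\<dots> \<le> Re (blinfun_apply \<phi> (adj ?S * ?S))"
        by (rule dom)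
      also have "blinfun_apply \<phi> (adj ?S * ?S) = of_real (?n\<^sup>2) * ?avg I"
        using n by (simp add: symmetric_state_average_square[OF \<phi>_sym] power2_eq_square)
      also have "Re \<dots> = ?n\<^sup>2 * Re (?avg I)"
        by (simp only: Re_complex_of_real Im_complex_of_real times_complex.sel mult_zero_left diff_0_right)
      finally show ?thesis
        by (rule mult_left_le_imp_le) (use n in simp)
    qed
    then have "eventually (\<lambda>I. t * (cmod (blinfun_apply \<psi> A))\<^sup>2 \<le> Re (?avg I)) (finite_subsets_at_top UNIV)"
      by (intro eventually_finite_subsets_at_top_weakI)
    then have "t * (cmod (blinfun_apply \<psi> A))\<^sup>2 \<le> 0"
      by (rule tendsto_lowerbound[OF lim]) simp
    then show ?thesis
      using \<open>0 < t\<close> by (simp add: mult_le_0_iff)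
  qed
  fix a
  have one: "blinfun_apply \<theta> (c *\<^sub>C 1) = c" if "\<theta> \<in> states" for \<theta> :: "'a free_group group_cstar \<Rightarrow>\<^sub>L complex" and c
    using that by (simp add: states_iff)
  have "blinfun_apply \<psi> (a - blinfun_apply \<phi> a *\<^sub>C 1) = 0"
    by (rule ker) (simp add: blinfun.diff_right one states)
  then show "blinfun_apply \<psi> a = blinfun_apply \<phi> a"
    by (simp add: blinfun.diff_right one states)
qed

lemma weakly_clustering_extreme:
  assumes "weakly_clustering \<phi>"
  shows "\<phi> extreme_point_of symmetric_states"
  unfolding extreme_point_of_def
proof (intro conjI ballI notI)
  show "\<phi> \<in> symmetric_states"
    using assms by (simp add: weakly_clustering_def)
  fix \<phi>1 \<phi>2
  assume S: "\<phi>1 \<in> symmetric_states" "\<phi>2 \<in> symmetric_states" and "\<phi> \<in> open_segment \<phi>1 \<phi>2"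
  then obtain u where "\<phi>1 \<noteq> \<phi>2" and u: "0 < u" "u < 1" and \<phi>: "\<phi> = (1 - u) *\<^sub>R \<phi>1 + u *\<^sub>R \<phi>2"
    by (auto simp: in_segment)
  have pos: "0 \<le> Re (blinfun_apply \<theta> (adj a * a))" if "\<theta> \<in> symmetric_states" for \<theta> :: "'a free_group group_cstar \<Rightarrow>\<^sub>L complex" and a
    using that by (simp add: symmetric_states_def states_iff complex_nonneg_Reals_iff)
  have "\<phi>1 = \<phi>"
    by (rule weakly_clustering_dominates[OF assms S(1), of "1 - u"])
       (use u pos[OF S(2)] in \<open>simp_all add: \<phi> blinfun.add_left blinfun.scaleR_left\<close>)
  moreover have "\<phi>2 = \<phi>"
    by (rule weakly_clustering_dominates[OF assms S(2), of u])
       (use u pos[OF S(1)] in \<open>simp_all add: \<phi> blinfun.add_left blinfun.scaleR_left\<close>)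
  ultimately show False
    using \<open>\<phi>1 \<noteq> \<phi>2\<close> by simp
qed

theorem mainTheorem7:
  fixes l :: real
  assumes "0 < l"
  shows "weakly_clustering (haagerup_state l) \<and>
    haagerup_state l extreme_point_of (symmetric_states :: (int free_group group_cstar \<Rightarrow>\<^sub>L complex) set)"
  using weakly_clustering_haagerup_state[OF assms] weakly_clustering_extreme by blast

end
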